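(* There exist absolute constants $C,c,r>0$ such that the following holds. Let $d\ge1$ be an integer, $\varepsilon\in(0,1]$, $\ell$ an integer with $r\le \ell\le rd$, $s\ge c\log(d/\ell)$, and $\bm m=(m_1,\dots,m_n)\in\mathbb{Z}_+^n$ with $m_k\in[r,\,r\varepsilon^{-2}]$ for all $k\in[n]$. If \[ \frac{\sum_{1\le k_1\ne k_2\le n}\sqrt{m_{k_1}m_{k_2}}}{n}\;\ge\; C\cdot\frac{d}{\sqrt{\ell}\,\varepsilon^2}, \] then there exists a protocol $\Pi$ for distributed Gaussian mean testing in dimension $d$ with threshold $\varepsilon$, with $n$ users sharing $s$ bits of public randomness, where user $k$ holds $m_k$ samples and every user sends $\ell$ bits, such that $\delta(\Pi)\le1/10$.
   Context: Distributed Gaussian mean testing. Let $\mathcal{G}(\bm{\mu},\mathbb{I}_d)$ denote the $d$-dimensional Gaussian with mean $\bm{\mu}\in\mathbb{R}^d$ and identity covariance. For a threshold $\varepsilon\in(0,1]$, let $\mathcal{H}_0=\{\mathcal{G}(\bm 0,\mathbb{I}_d)\}$ and $\mathcal{H}_1=\{\mathcal{G}(\bm\mu,\mathbb{I}_d):\|\bm\mu\|_2\ge\varepsilon\}$. There are $n$ users and a referee; an unknown $G\in\mathcal{H}_0\cup\mathcal{H}_1$ is fixed. User $k\in[n]$ observes $m_k\ge1$ i.i.d. samples $X^{(k)}=(\bm X^{(k,1)},\dots,\bm X^{(k,m_k)})$ from $G$ (independent across users) and sends the message $\bm Y^{(k)}=W^{(k)}(X^{(k)})\in\{0,1\}^{\ell_k}$,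 where the encoding functions $W^{(k)}:\mathbb{R}^{d m_k}\to\{0,1\}^{\ell_k}$ may be randomized using $s\ge0$ uniformly random bits shared by all users (public randomness, used to jointly sample the tuple $(W^{(1)},\dots,W^{(n)})$) together with arbitrary private randomness independent across users. The referee applies a test $T:\{0,1\}^{\ell_1}\times\cdots\times\{0,1\}^{\ell_n}\to\{0,1\}$ to $(\bm Y^{(1)},\dots,\bm Y^{(n)})$ and accepts $\mathcal{H}_0$ iff the output is $0$. For the protocol $\Pi=((W^{(k)})_k,T)$, the error is $\delta(\Pi)=\max\left(\sup_{G\in\mathcal{H}_0}\Pr[T=1],\ \sup_{G\in\mathcal{H}_1}\Pr[T=0]\right)$. Here all $\ell_k=\ell$. *)

theory Defs
  imports "HOL-Probability.Probability"
begin

text \<open>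
  Vectors of \<open>\<real>\<^sup>d\<close> are functions \<open>nat \<Rightarrow> real\<close> in \<^term>\<open>{..<d} \<rightarrow>\<^sub>E UNIV\<close>, since the
  dimension is quantified inside the theorem, after the absolute constants.  Mean vectors are
  arbitrary functions of which only the coordinates below \<open>d\<close> are used.
\<close>

definition gaussian :: "nat \<Rightarrow> (nat \<Rightarrow> real) \<Rightarrow> (nat \<Rightarrow> real) measure" where
  "gaussian d \<mu> = density (PiM {..<d} (\<lambda>_. lborel))
     (\<lambda>x. ennreal (exp (- (\<Sum>i<d. (x i - \<mu> i)\<^sup>2) / 2) / sqrt (2 * pi) ^ d))"

lemma gaussian_eq_PiM:
  "gaussian d \<mu> = PiM {..<d} (\<lambda>i. density lborel (normal_density (\<mu> i) 1))"
proof -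
  let ?N = "\<lambda>i. density lborel (\<lambda>x. ennreal (normal_density (\<mu> i) 1 x))"
  interpret N: prob_space "?N i" for i
    by (rule prob_space_normal_density) simp
  interpret N: product_sigma_finite ?N ..
  interpret L: product_sigma_finite "\<lambda>_::nat. lborel :: real measure" ..
  have dens: "exp (- (\<Sum>i<d. (x i - \<mu> i)\<^sup>2) / 2) / sqrt (2 * pi) ^ d
      = (\<Prod>i<d. normal_density (\<mu> i) 1 (x i))" for x
    by (simp add: normal_density_def prod_dividef exp_sum [symmetric] sum_negf sum_divide_distrib
        prod.distrib)
  show ?thesis
  proof (rule N.PiM_eqI)
    show "finite {..<d}" by simp
    show "sets (gaussian d \<mu>) = sets (PiM {..<d} ?N)"
      unfolding gaussian_def by (simp cong: sets_PiM_cong)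
    fix A assume "\<And>i. i \<in> {..<d} \<Longrightarrow> A i \<in> sets (?N i)"
    then have A: "\<And>i. i < d \<Longrightarrow> A i \<in> sets borel" by simp
    have "emeasure (gaussian d \<mu>) (PiE {..<d} A)
        = (\<integral>\<^sup>+x. ennreal (\<Prod>i<d. normal_density (\<mu> i) 1 (x i)) * indicator (PiE {..<d} A) x
            \<partial>PiM {..<d} (\<lambda>_. lborel))"
      unfolding gaussian_def dens using A
      by (intro emeasure_density) (auto intro!: sets_PiM_I_finite)
    also have "\<dots> = (\<integral>\<^sup>+x. (\<Prod>i<d. ennreal (normal_density (\<mu> i) 1 (x i)) * indicator (A i) (x i))
            \<partial>PiM {..<d} (\<lambda>_. lborel))"
    proof (rule nn_integral_cong)
      fix x :: "nat \<Rightarrow> real" assume "x \<in> space (PiM {..<d} (\<lambda>_. lborel))"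
      then have "indicator (PiE {..<d} A) x = (\<Prod>i<d. indicator (A i) (x i) :: ennreal)"
        by (auto simp: space_PiM indicator_def PiE_iff)
      then show "ennreal (\<Prod>i<d. normal_density (\<mu> i) 1 (x i)) * indicator (PiE {..<d} A) x
          = (\<Prod>i<d. ennreal (normal_density (\<mu> i) 1 (x i)) * indicator (A i) (x i))"
        by (simp add: prod.distrib prod_ennreal)
    qed
    also have "\<dots> = (\<Prod>i<d. \<integral>\<^sup>+x. ennreal (normal_density (\<mu> i) 1 x) * indicator (A i) x \<partial>lborel)"
      using A by (intro L.product_nn_integral_prod) auto
    also have "\<dots> = (\<Prod>i<d. emeasure (?N i) (A i))"
      using A by (intro prod.cong refl) (simp add: emeasure_density)
    finally show "emeasure (gaussian d \<mu>) (PiE {..<d} A) = (\<Prod>i<d. emeasure (?N i) (A i))" .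
  qed
qed

lemma prob_space_gaussian: "prob_space (gaussian d \<mu>)"
  unfolding gaussian_eq_PiM by (intro prob_space_PiM prob_space_normal_density) simp

lemma sets_gaussian [measurable_cong]: "sets (gaussian d \<mu>) = sets (PiM {..<d} (\<lambda>_. borel))"
  unfolding gaussian_def by (simp cong: sets_PiM_cong)

definition null_hyp :: "nat \<Rightarrow> (nat \<Rightarrow> real) measure set" where
  "null_hyp d = {gaussian d (\<lambda>_. 0)}"

definition alt_hyp :: "nat \<Rightarrow> real \<Rightarrow> (nat \<Rightarrow> real) measure set" where
  "alt_hyp d \<epsilon> = {gaussian d \<mu> | \<mu>. L2_set \<mu> {..<d} \<ge> \<epsilon>}"

definition bits :: "nat \<Rightarrow> bool list set" where
  "bits l = {w. length w = l}"

text \<open>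
  Users are \<open>0, \<dots>, n - 1\<close>.  User \<open>k\<close> draws a private random element of law \<open>priv P k\<close>, and
  \<open>enc P k u z x\<close> is the message it sends on public seed \<open>u\<close>, private randomness \<open>z\<close> and samples
  \<open>x 0, \<dots>, x (m k - 1)\<close>.  The referee sees the messages only (not the seed);
  \<^term>\<open>True\<close> encodes the output \<open>1\<close>, i.e. rejection of the null hypothesis.
  Taking \<open>'r = real\<close> is no restriction in practice: any standard Borel private randomness is
  carried by the reals.
\<close>

record 'r protocol =
  priv :: "nat \<Rightarrow> 'r measure"
  enc :: "nat \<Rightarrow> bool list \<Rightarrow> 'r \<Rightarrow> (nat \<Rightarrow> nat \<Rightarrow> real) \<Rightarrow> bool list"
  test :: "(nat \<Rightarrow> bool list) \<Rightarrow> bool"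

definition is_protocol ::
    "nat \<Rightarrow> nat \<Rightarrow> nat \<Rightarrow> (nat \<Rightarrow> nat) \<Rightarrow> (nat \<Rightarrow> nat) \<Rightarrow> 'r protocol \<Rightarrow> bool" where
  "is_protocol d n s m l P \<longleftrightarrow> (\<forall>k<n. prob_space (priv P k) \<and>
     (\<lambda>(u, z, x). enc P k u z x) \<in>
       uniform_count_measure (bits s) \<Otimes>\<^sub>M (priv P k \<Otimes>\<^sub>M PiM {..<m k} (\<lambda>_. PiM {..<d} (\<lambda>_. borel)))
         \<rightarrow>\<^sub>M count_space (bits (l k)))"

text \<open>
  The probability space of a run: the public seed, together with the private randomness and the
  samples of every user, all independent.
\<close>

definition run_space ::
    "nat \<Rightarrow> nat \<Rightarrow> (nat \<Rightarrow> nat) \<Rightarrow> 'r protocol \<Rightarrow> (nat \<Rightarrow> real) measure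
       \<Rightarrow> (bool list \<times> (nat \<Rightarrow> 'r \<times> (nat \<Rightarrow> nat \<Rightarrow> real))) measure" where
  "run_space n s m P G =
     uniform_count_measure (bits s) \<Otimes>\<^sub>M PiM {..<n} (\<lambda>k. priv P k \<Otimes>\<^sub>M PiM {..<m k} (\<lambda>_. G))"

definition messages ::
    "nat \<Rightarrow> 'r protocol \<Rightarrow> bool list \<times> (nat \<Rightarrow> 'r \<times> (nat \<Rightarrow> nat \<Rightarrow> real)) \<Rightarrow> nat \<Rightarrow> bool list" where
  "messages n P = (\<lambda>(u, \<omega>). \<lambda>k\<in>{..<n}. enc P k u (fst (\<omega> k)) (snd (\<omega> k)))"

definition output_prob ::
    "nat \<Rightarrow> nat \<Rightarrow> (nat \<Rightarrow> nat) \<Rightarrow> 'r protocol \<Rightarrow> (nat \<Rightarrow> real) measure \<Rightarrow> bool \<Rightarrow> real" where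
  "output_prob n s m P G b =
     \<P>(\<omega> in run_space n s m P G. test P (messages n P \<omega>) = b)"

definition protocol_error ::
    "nat \<Rightarrow> real \<Rightarrow> nat \<Rightarrow> nat \<Rightarrow> (nat \<Rightarrow> nat) \<Rightarrow> 'r protocol \<Rightarrow> real" where
  "protocol_error d \<epsilon> n s m P =
     max (SUP G\<in>null_hyp d. output_prob n s m P G True)
         (SUP G\<in>alt_hyp d \<epsilon>. output_prob n s m P G False)"

lemma finite_bits: "finite (bits l)"
  using finite_lists_length_eq [of "UNIV :: bool set" l] by (simp add: bits_def)

lemma bits_nonempty: "bits l \<noteq> {}"
  by (auto simp: bits_def intro: exI [of _ "replicate l True"])

lemma prob_space_run_space:
  assumes "is_protocol d n s m l P" and "prob_space G"
  shows "prob_space (run_space n s m P G)"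
  using assms unfolding run_space_def is_protocol_def
  by (intro prob_space_pair prob_space_PiM prob_space_uniform_count_measure
      finite_bits bits_nonempty) auto

lemma measurable_messages:
  assumes P: "is_protocol d n s m l P" and G: "sets G = sets (PiM {..<d} (\<lambda>_. borel))"
  shows "messages n P \<in> run_space n s m P G \<rightarrow>\<^sub>M count_space (PiE {..<n} (\<lambda>k. bits (l k)))"
proof -
  have eq: "count_space (PiE {..<n} (\<lambda>k. bits (l k))) = PiM {..<n} (\<lambda>k. count_space (bits (l k)))"
    by (rule count_space_PiM_finite [symmetric]) (auto intro: countable_finite finite_bits)
  have "(\<lambda>(u, \<omega>). enc P k u (fst (\<omega> k)) (snd (\<omega> k))) \<in> run_space n s m P G \<rightarrow>\<^sub>M count_space (bits (l k))"
    if k: "k < n" for k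
  proof -
    let ?U = "uniform_count_measure (bits s)"
    have S: "sets (PiM {..<m k} (\<lambda>_. G)) = sets (PiM {..<m k} (\<lambda>_. PiM {..<d} (\<lambda>_. borel)))"
      using G by (intro sets_PiM_cong) auto
    have 1: "(\<lambda>(u, z, x). enc P k u z x) \<in> ?U \<Otimes>\<^sub>M (priv P k \<Otimes>\<^sub>M PiM {..<m k} (\<lambda>_. G)) \<rightarrow>\<^sub>M count_space (bits (l k))"
      using P k unfolding is_protocol_def
      by (subst measurable_cong_sets [OF sets_pair_measure_cong [OF refl sets_pair_measure_cong [OF refl S]] refl]) auto
    have 2: "(\<lambda>p. (fst p, snd p k)) \<in> run_space n s m P G \<rightarrow>\<^sub>M ?U \<Otimes>\<^sub>M (priv P k \<Otimes>\<^sub>M PiM {..<m k} (\<lambda>_. G))"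
      unfolding run_space_def using k
      by (intro measurable_Pair measurable_fst
          measurable_compose [OF measurable_snd measurable_component_singleton]) auto
    show ?thesis
      using measurable_compose [OF 2 1] by (simp add: case_prod_unfold)
  qed
  then show ?thesis
    unfolding eq messages_def case_prod_unfold
    by (intro measurable_restrict) auto
qed

end

theory Submission
  imports Defs
begin

text \<open>
  The coordinates are split into \<open>l\<close> blocks of at most \<open>D = d div l + 1\<close> coordinates, and the public seed selects
  a direction \<open>v\<close> in \<open>\<real>\<^sup>D\<close>.  The \<open>g\<close>-th bit of a user is the sign of the inner product of \<open>v\<close> with the \<open>g\<close>-th
  block of the sum of the user's samples.  Given the seed, all bits are independent; they are fair under the null
  hypothesis, and under mean \<open>\<mu>\<close> the bits of user \<open>k\<close> have bias of order \<open>sqrt (m k)\<close> times the component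
  of the block of \<open>\<mu>\<close> along \<open>v\<close>.  The referee thresholds the number of agreeing pairs of bits of distinct users, whose
  mean and variance give the stated condition through Chebyshev's inequality.

  With only \<open>O(ln (d / l))\<close> public bits, \<open>v\<close> must be drawn from a family of polynomial size in \<open>D\<close> such that
  every \<open>a \<in> \<real>\<^sup>D\<close> satisfies \<open>\<langle>v, a\<rangle>\<^sup>2 \<ge> \<delta> \<bar>a\<bar>\<^sup>2 / D\<close> for most seeds.  Exponential vectors with Sidon
  frequencies achieve this for a constant fraction of the seeds, by the Paley-Zygmund inequality, and combinations
  \<open>v + z w\<close> of independent draws with a small random integer \<open>z\<close> roughly square the failure probability.
\<close>

subsection \<open>Anti-concentrated families of directions\<close>

text \<open>Two users have biases of the same sign at the same block, whichever sign it is, so the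
  product of their bits has a positive mean: this is why pairs are counted. Signs saturate, a block
  of large norm giving a bias of at most 1. The lower bounds are therefore made with block energies
  capped at \<open>\<epsilon>\<^sup>2\<close>, which still sum to at least
  \<open>\<epsilon>\<^sup>2\<close>; the upper bound on \<open>m k\<close> keeps the biases linear
  below the cap. Under an alternative the error 1/10 is split evenly between Chebyshev's inequality
  and the bad seeds. Passing from single blocks to the total energy by Markov's inequality doubles
  the failure probability, so failure 1/40 is required of a family, far below what Paley-Zygmund
  gives. Norm at most 1 is asked so that normalizing a projection can only enlarge its mean. Entry 0
  must be positive because every block contains the position 0, even when its last position is
  missing, so that no projection is degenerate.\<close>

definition spread_family :: "real \<Rightarrow> real \<Rightarrow> nat \<Rightarrow> 'a set \<Rightarrow> ('a \<Rightarrow> nat \<Rightarrow> real) \<Rightarrow> bool" where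
  "spread_family p \<delta> D S u \<longleftrightarrow> finite S \<and>
     (\<forall>z\<in>S. 0 < u z 0 \<and> (\<Sum>j<D. (u z j)\<^sup>2) \<le> 1) \<and>
     (\<forall>a. real (card {z\<in>S. (\<Sum>j<D. u z j * a j)\<^sup>2 < \<delta> * (\<Sum>j<D. (a j)\<^sup>2) / real D}) \<le> p * real (card S))"

lemma spread_family_reindex:
  assumes u: "spread_family p \<delta> D S u" and f: "bij_betw f T S"
  shows "spread_family p \<delta> D T (\<lambda>z. u (f z))"
proof -
  have fin: "finite T" using u f bij_betw_finite by (auto simp: spread_family_def)
  have c: "card T = card S" by (rule bij_betw_same_card[OF f])
  have "card {z\<in>T. P (f z)} = card {z\<in>S. P z}" for P
  proof -
    have "bij_betw f {z\<in>T. P (f z)} {z\<in>S. P z}"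
      using f by (auto simp: bij_betw_def inj_on_def)
    then show ?thesis by (rule bij_betw_same_card)
  qed
  note this[of "\<lambda>z. (\<Sum>j<D. u z j * a j)\<^sup>2 < \<delta> * (\<Sum>j<D. (a j)\<^sup>2) / real D" for a]
  then show ?thesis using u fin c bij_betwE[OF f] by (auto simp: spread_family_def)
qed

lemma spread_family_times:
  assumes u: "spread_family p \<delta> D S u" and T: "finite T"
  shows "spread_family p \<delta> D (S \<times> T) (\<lambda>z. u (fst z))"
proof -
  have "card {z\<in>S\<times>T. P (fst z)} = card {z\<in>S. P z} * card T" for P
  proof -
    have "{z\<in>S\<times>T. P (fst z)} = {z\<in>S. P z} \<times> T" by auto
    then show ?thesis by (simp add: card_cartesian_product)
  qed
  note this[of "\<lambda>z. (\<Sum>j<D. u z j * a j)\<^sup>2 < \<delta> * (\<Sum>j<D. (a j)\<^sup>2) / real D" for a]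
  then show ?thesis using u T
    by (auto simp: spread_family_def card_cartesian_product mult.assoc[symmetric] intro!: mult_right_mono)
qed

text \<open>Two such multipliers would make y small by subtraction,
  \<open>\<bar>y\<bar> < t / (2 * Z)\<close>, and then x as well,
  \<open>\<bar>x\<bar> < 3/4 * t\<close>, because the multipliers run over 1, ..., Z and so
  \<open>real (Suc z) * \<bar>y\<bar>\<close> is at most \<open>t / 2\<close>.\<close>

lemma card_small_combination_le_1:
  fixes x y t :: real and Z :: nat
  assumes t: "0 < t" and max: "t \<le> \<bar>x\<bar> \<or> t \<le> \<bar>y\<bar>" and Z: "Z \<ge> 1"
  shows "card {z\<in>{..<Z}. \<bar>x + real (Suc z) * y\<bar> < t / (4 * real Z)} \<le> 1"
proof -
  have "z = w" if "z < Z" "w < Z" and z: "\<bar>x + real (Suc z) * y\<bar> < t / (4 * real Z)"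
    and w: "\<bar>x + real (Suc w) * y\<bar> < t / (4 * real Z)" for z w
  proof (rule ccontr)
    assume "z \<noteq> w"
    then have "1 \<le> \<bar>real (Suc z) - real (Suc w)\<bar>" by linarith
    then have "\<bar>y\<bar> \<le> \<bar>real (Suc z) - real (Suc w)\<bar> * \<bar>y\<bar>"
      using mult_right_mono[of 1 _ "\<bar>y\<bar>"] by simp
    also have "\<dots> = \<bar>(x + real (Suc z) * y) - (x + real (Suc w) * y)\<bar>"
      unfolding abs_mult[symmetric] by (simp add: algebra_simps)
    also have "\<dots> < t / (2 * real Z)" using z w by (simp add: field_simps)
    finally have y: "\<bar>y\<bar> < t / (2 * real Z)" .
    have "\<bar>x\<bar> \<le> \<bar>x + real (Suc z) * y\<bar> + real (Suc z) * \<bar>y\<bar>"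
      using abs_triangle_ineq4[of "x + real (Suc z) * y" "real (Suc z) * y"]
      by (simp add: abs_mult)
    also have "real (Suc z) * \<bar>y\<bar> \<le> real Z * (t / (2 * real Z))"
      using \<open>z < Z\<close> y by (intro mult_mono) auto
    also have "real Z * (t / (2 * real Z)) = t / 2" using Z by simp
    finally have "\<bar>x\<bar> < t / (4 * real Z) + t / 2" using z by simp
    moreover have "t / (4 * real Z) \<le> t / 4" "t / (2 * real Z) \<le> t / 2"
      using t Z by (simp_all add: field_simps mult_le_cancel_left1)
    ultimately show False using y max t by linarith
  qed
  then have "\<forall>z\<in>{z\<in>{..<Z}. \<bar>x + real (Suc z) * y\<bar> < t / (4 * real Z)}.
      \<forall>w\<in>{z\<in>{..<Z}. \<bar>x + real (Suc z) * y\<bar> < t / (4 * real Z)}. z = w"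
    by blast
  then show ?thesis unfolding One_nat_def by (subst card_le_Suc0_iff_eq) simp_all
qed

text \<open>Union bound over two ways to fail: both projections of the sample are small, with
  probability p, or the multiplier is the one exceptional value allowed to that sample, with
  probability 1/Z. The divisor 2 Z restores norm at most 1; together with the margin
  \<open>t / (4 * Z)\<close> it turns the threshold \<open>t\<^sup>2\<close> into
  \<open>t\<^sup>2 / (64 * Z ^ 4)\<close>. Both v and w are functions of one sample, since they
  serve once as cosine and sine of the same angles and once as two independent draws.\<close>

lemma spread_family_combine:
  fixes v w :: "'a \<Rightarrow> nat \<Rightarrow> real" and S :: "'a set"
  assumes fin: "finite S" and Z: "Z \<ge> 1" and D: "D \<ge> 1" and \<delta>: "0 < \<delta>"
    and pos: "\<And>z. z \<in> S \<Longrightarrow> 0 < v z 0 \<and> 0 \<le> w z 0"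
    and v: "\<And>z. z \<in> S \<Longrightarrow> (\<Sum>j<D. (v z j)\<^sup>2) \<le> 1"
    and w: "\<And>z. z \<in> S \<Longrightarrow> (\<Sum>j<D. (w z j)\<^sup>2) \<le> 1"
    and bad: "\<And>a. real (card {z\<in>S. (\<Sum>j<D. v z j * a j)\<^sup>2 < \<delta> * (\<Sum>j<D. (a j)\<^sup>2) / real D \<and>
        (\<Sum>j<D. w z j * a j)\<^sup>2 < \<delta> * (\<Sum>j<D. (a j)\<^sup>2) / real D}) \<le> p * real (card S)"
  shows "spread_family (p + 1 / real Z) (\<delta> / (64 * real Z ^ 4)) D (S \<times> {..<Z})
    (\<lambda>(s, z) j. (v s j + real (Suc z) * w s j) / (2 * real Z))"
proof -
  define u where "u = (\<lambda>(s, z) j. (v s j + real (Suc z) * w s j) / (2 * real Z))"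
  have Z0: "real Z > 0" using Z by simp
  have norm: "(\<Sum>j<D. (u (s, z) j)\<^sup>2) \<le> 1" if s: "s \<in> S" and z: "z < Z" for s z
  proof -
    have "(u (s, z) j)\<^sup>2 \<le> (v s j)\<^sup>2 / 2 + (w s j)\<^sup>2 / 2" for j
    proof -
      have 1: "real (Suc z) \<le> real Z" "1 \<le> real Z" using z Z by auto
      have "(v s j + real (Suc z) * w s j)\<^sup>2 \<le> 2 * (v s j)\<^sup>2 + 2 * (real (Suc z) * w s j)\<^sup>2"
        using sum_squares_bound[of "v s j" "real (Suc z) * w s j"] by (simp add: power2_sum)
      also have "\<dots> \<le> 2 * (real Z)\<^sup>2 * (v s j)\<^sup>2 + 2 * (real Z)\<^sup>2 * (w s j)\<^sup>2"
        using 1 by (auto simp: power_mult_distrib intro!: add_mono mult_right_mono mult_left_mono power_mono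
            simp del: of_nat_Suc)
      finally show ?thesis using Z0 by (simp add: u_def power_divide field_simps power2_eq_square)
    qed
    then have "(\<Sum>j<D. (u (s, z) j)\<^sup>2) \<le> (\<Sum>j<D. (v s j)\<^sup>2 / 2 + (w s j)\<^sup>2 / 2)"
      by (intro sum_mono)
    also have "\<dots> \<le> 1" using v[OF s] w[OF s]
      by (simp add: sum.distrib sum_divide_distrib[symmetric])
    finally show ?thesis .
  qed
  have cnt: "real (card {z\<in>S \<times> {..<Z}. (\<Sum>j<D. u z j * a j)\<^sup>2 < \<delta> / (64 * real Z ^ 4) * (\<Sum>j<D. (a j)\<^sup>2) / real D})
      \<le> (p + 1 / real Z) * real (card (S \<times> {..<Z}))" (is "real (card ?B) \<le> _") for a
  proof -
    define A where "A = (\<Sum>j<D. (a j)\<^sup>2)"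
    define x where "x z = (\<Sum>j<D. v z j * a j)" for z
    define y where "y z = (\<Sum>j<D. w z j * a j)" for z
    define t where "t = sqrt (\<delta> * A / real D)"
    have A0: "A \<ge> 0" by (simp add: A_def sum_nonneg)
    define G where "G = {z\<in>S. (x z)\<^sup>2 < \<delta> * A / real D \<and> (y z)\<^sup>2 < \<delta> * A / real D}"
    have ux: "(\<Sum>j<D. u (s, z) j * a j) = (x s + real (Suc z) * y s) / (2 * real Z)" for s z
      by (simp add: u_def x_def y_def sum_divide_distrib[symmetric] sum_distrib_left sum.distrib algebra_simps
          add_divide_distrib)
    show ?thesis
    proof (cases "A = 0")
      case True
      \<comment> \<open>The inequality that defines failure is strict, so nothing fails for the zero
        vector.\<close>
      then have "?B = {}" unfolding A_def[symmetric] by simp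
      have "0 \<le> p * real (card S)" using bad[of a] by (meson of_nat_0_le_iff order_trans)
      then have "0 \<le> p * real (card S) * real Z + real (card S)"
        using Z0 by (intro add_nonneg_nonneg[OF mult_nonneg_nonneg]) simp_all
      also have "\<dots> = (p + 1 / real Z) * real (card (S \<times> {..<Z}))"
        using Z0 by (simp add: card_cartesian_product algebra_simps)
      finally show ?thesis by (simp only: \<open>?B = {}\<close> card.empty of_nat_0)
    next
      case False
      then have t0: "t > 0" using A0 \<delta> D by (auto simp: t_def)
      have t2: "t\<^sup>2 = \<delta> * A / real D" using A0 \<delta> by (simp add: t_def)
      define H where "H s = {z\<in>{..<Z}. \<bar>x s + real (Suc z) * y s\<bar> < t / (4 * real Z)}" for s
      have H1: "card (H s) \<le> 1" if "s \<in> S - G" for s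
      proof -
        have "t\<^sup>2 \<le> (x s)\<^sup>2 \<or> t\<^sup>2 \<le> (y s)\<^sup>2" using that by (auto simp: G_def t2)
        then have "t \<le> \<bar>x s\<bar> \<or> t \<le> \<bar>y s\<bar>" using t0 by (simp add: abs_le_square_iff[symmetric])
        then show ?thesis unfolding H_def by (intro card_small_combination_le_1 t0 Z)
      qed
      have "?B \<subseteq> G \<times> {..<Z} \<union> Sigma (S - G) H"
      proof (rule subrelI)
        fix s z assume B: "(s, z) \<in> ?B"
        then have s: "s \<in> S" and z: "z < Z"
          and lt: "(\<Sum>j<D. u (s, z) j * a j)\<^sup>2 < \<delta> / (64 * real Z ^ 4) * (\<Sum>j<D. (a j)\<^sup>2) / real D"
          by auto
        have "(x s + real (Suc z) * y s)\<^sup>2 < (t / (4 * real Z))\<^sup>2"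
          using lt Z0 unfolding ux A_def[symmetric] power_divide t2
          by (simp add: field_simps power2_eq_square power4_eq_xxxx) 
        then have "\<bar>x s + real (Suc z) * y s\<bar> < t / (4 * real Z)"
          using power2_less_imp_less[of "\<bar>x s + real (Suc z) * y s\<bar>" "t / (4 * real Z)"] t0 Z0
          unfolding power2_abs by (meson divide_nonneg_pos less_imp_le mult_pos_pos zero_less_numeral)
        then have "z \<in> H s" using z by (simp add: H_def)
        then show "(s, z) \<in> G \<times> {..<Z} \<union> Sigma (S - G) H" using s z by auto
      qed
      then have "card ?B \<le> card (G \<times> {..<Z} \<union> Sigma (S - G) H)"
        using fin by (intro card_mono) (auto simp: G_def H_def)
      also have "\<dots> \<le> card (G \<times> {..<Z}) + card (Sigma (S - G) H)" by (rule card_Un_le)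
      also have "card (Sigma (S - G) H) = (\<Sum>s\<in>S - G. card (H s))"
        using fin by (intro card_SigmaI) (auto simp: H_def)
      also have "\<dots> \<le> (\<Sum>s\<in>S - G. 1)" by (intro sum_mono H1)
      also have "\<dots> \<le> card S" using fin by (simp add: card_mono)
      finally have "real (card ?B) \<le> real (card G) * real Z + real (card S)"
        by (simp add: card_cartesian_product flip: of_nat_mult of_nat_add)
      also have "real (card G) \<le> p * real (card S)"
        using bad[of a] by (simp add: G_def x_def y_def A_def)
      finally show ?thesis using Z0
        by (simp add: card_cartesian_product algebra_simps)
    qed
  qed
  have "0 < u z 0" if "z \<in> S \<times> {..<Z}" for z
    using that pos Z0 by (auto simp: u_def add_pos_nonneg)
  then show ?thesis using norm cnt fin unfolding spread_family_def u_def[symmetric] by auto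
qed

text \<open>Two independent draws are both bad with probability at most \<open>p\<^sup>2\<close>.
  The seed doubles in length, up to the bits of the multiplier, and the threshold loses a factor
  that depends on Z only.\<close>

lemma spread_family_double:
  assumes u: "spread_family p \<delta> D S u" and Z: "Z \<ge> 1" and D: "D \<ge> 1" and \<delta>: "0 < \<delta>"
  shows "spread_family (p\<^sup>2 + 1 / real Z) (\<delta> / (64 * real Z ^ 4)) D ((S \<times> S) \<times> {..<Z})
    (\<lambda>(s, z) j. (u (fst s) j + real (Suc z) * u (snd s) j) / (2 * real Z))"
proof (rule spread_family_combine[OF _ Z D \<delta>])
  show "finite (S \<times> S)" using u by (simp add: spread_family_def)
  fix z assume "z \<in> S \<times> S"
  then show "0 < u (fst z) 0 \<and> 0 \<le> u (snd z) 0"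
    "(\<Sum>j<D. (u (fst z) j)\<^sup>2) \<le> 1" "(\<Sum>j<D. (u (snd z) j)\<^sup>2) \<le> 1"
    using u by (auto simp: spread_family_def intro: less_imp_le)
next
  fix a
  let ?B = "{z\<in>S. (\<Sum>j<D. u z j * a j)\<^sup>2 < \<delta> * (\<Sum>j<D. (a j)\<^sup>2) / real D}"
  let ?C = "{z\<in>S \<times> S. (\<Sum>j<D. u (fst z) j * a j)\<^sup>2 < \<delta> * (\<Sum>j<D. (a j)\<^sup>2) / real D \<and>
        (\<Sum>j<D. u (snd z) j * a j)\<^sup>2 < \<delta> * (\<Sum>j<D. (a j)\<^sup>2) / real D}"
  have "?C = ?B \<times> ?B" by auto
  then have "real (card ?C) = real (card ?B) * real (card ?B)" by (simp add: card_cartesian_product)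
  also have "\<dots> \<le> (p * real (card S)) * (p * real (card S))"
    using u by (intro mult_mono) (auto simp: spread_family_def intro: order_trans[OF of_nat_0_le_iff])
  finally show "real (card ?C) \<le> p\<^sup>2 * real (card (S \<times> S))"
    by (simp add: card_cartesian_product power2_eq_square ac_simps)
qed

section \<open>Moments of exponential polynomials with Sidon frequencies\<close>

lemma sum_cis_roots_of_unity:
  fixes m :: int and q :: nat
  assumes "\<bar>m\<bar> < int q"
  shows "(\<Sum>b<q. cis (2 * pi * real b * of_int m / real q)) = (if m = 0 then of_nat q else 0)"
proof (cases "m = 0")
  case False
  define w where "w = cis (2 * pi * of_int m / real q)"
  have q: "q > 0" using assms by auto
  have pow: "cis (2 * pi * real b * of_int m / real q) = w ^ b" for b
    unfolding w_def Complex.DeMoivre by (rule arg_cong[where f=cis]) simp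
  have "w ^ q = cis (2 * pi * of_int m)"
    unfolding pow[symmetric] by (rule arg_cong[where f=cis]) (use q in simp)
  also have "\<dots> = 1" by (rule cis_multiple_2pi) simp
  finally have wq: "w ^ q = 1" .
  \<comment> \<open>The only multiple of q in the allowed range is 0, so for
    \<open>m \<noteq> 0\<close> the ratio of the geometric sum is not 1.\<close>
  have "w \<noteq> 1"
  proof
    assume "w = 1"
    then have "cos (2 * pi * of_int m / real q) = 1" by (simp add: w_def complex_eq_iff)
    then obtain k :: int where "2 * pi * of_int m / real q = of_int k * 2 * pi"
      by (auto simp: cos_one_2pi_int)
    then have "real_of_int m = of_int (k * int q)" using q by (simp add: field_simps)
    then have "m = k * int q" by (simp only: of_int_eq_iff)
    then have "int q dvd m" by simp
    then show False using zdvd_not_zless[of "\<bar>m\<bar>" "int q"] assms False by auto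
  qed
  then have "(\<Sum>b<q. w ^ b) = 0" using geometric_sum[of w q] wq by simp
  then show ?thesis using False by (simp add: pow)
qed simp

text \<open>Orthogonality of the characters modulo q. Frequencies may repeat, as they do for the
  square of a polynomial, where H is a sum over a pair; so one identity gives both the second and
  the fourth moment.\<close>

lemma finite_parseval:
  fixes c :: "'i \<Rightarrow> real" and H :: "'i \<Rightarrow> nat"
  assumes I: "finite I" and H: "\<And>i. i \<in> I \<Longrightarrow> H i < q"
  shows "(\<Sum>b<q. (cmod (\<Sum>i\<in>I. of_real (c i) * cis (2 * pi * real b * real (H i) / real q)))\<^sup>2)
    = real q * (\<Sum>i\<in>I. \<Sum>j\<in>I. if H i = H j then c i * c j else 0)"
proof -
  let ?e = "\<lambda>b m. cis (2 * pi * real b * m / real q)"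
  have "complex_of_real (\<Sum>b<q. (cmod (\<Sum>i\<in>I. of_real (c i) * ?e b (real (H i))))\<^sup>2)
      = (\<Sum>b<q. (\<Sum>i\<in>I. of_real (c i) * ?e b (real (H i))) * (\<Sum>i\<in>I. of_real (c i) * ?e b (- real (H i))))"
    by (simp add: complex_norm_square cis_cnj del: of_real_power)
  also have "\<dots> = (\<Sum>b<q. \<Sum>i\<in>I. \<Sum>j\<in>I. of_real (c i * c j) * ?e b (of_int (int (H i) - int (H j))))"
  proof -
    have e: "?e b x * ?e b (- y) = ?e b (x - y)" for b x y
      unfolding cis_mult by (simp add: diff_divide_distrib algebra_simps)
    have "(of_real (c i) * ?e b x) * (of_real (c j) * ?e b (- y)) = of_real (c i * c j) * ?e b (x - y)" for b i j x y
    proof -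
      have "(of_real (c i) * ?e b x) * (of_real (c j) * ?e b (- y)) = of_real (c i * c j) * (?e b x * ?e b (- y))"
        unfolding of_real_mult by (simp only: mult_ac)
      then show ?thesis by (simp only: e)
    qed
    then show ?thesis
      by (simp only: sum_product of_int_diff of_int_of_nat_eq)
  qed
  also have "\<dots> = (\<Sum>i\<in>I. \<Sum>j\<in>I. of_real (c i * c j) * (\<Sum>b<q. ?e b (of_int (int (H i) - int (H j)))))"
    by (subst sum.swap, intro sum.cong refl, subst sum.swap) (simp add: sum_distrib_left)
  also have "\<dots> = (\<Sum>i\<in>I. \<Sum>j\<in>I. of_real (c i * c j) * (if H i = H j then of_nat q else 0))"
  proof (intro sum.cong refl arg_cong2[where f="(*)"])
    fix i j assume "i \<in> I" "j \<in> I"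
    then have "\<bar>int (H i) - int (H j)\<bar> < int q" using H[of i] H[of j] by linarith
    from sum_cis_roots_of_unity[OF this]
    show "(\<Sum>b<q. ?e b (of_int (int (H i) - int (H j)))) = (if H i = H j then of_nat q else 0)" by simp
  qed
  also have "\<dots> = complex_of_real (real q * (\<Sum>i\<in>I. \<Sum>j\<in>I. if H i = H j then c i * c j else 0))"
    by (simp add: sum_distrib_left) (auto intro!: sum.cong)
  finally show ?thesis by (simp only: of_real_eq_iff)
qed

text \<open>Two digits in base 2 D: a sum of two values shows \<open>i + j\<close>, which is below 2
  D, as its remainder and \<open>i\<^sup>2 + j\<^sup>2\<close> as its quotient, and these determine
  the unordered pair. The values are cubic in D, so the modulus stays polynomial and costs O(ln D)
  seed bits.\<close>

definition sidon :: "nat \<Rightarrow> nat \<Rightarrow> nat" where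
  "sidon D j = j + 2 * D * j\<^sup>2"

text \<open>Sums of two frequencies stay below the modulus, so the Sidon property is needed over the
  integers only, without wraparound. Each frequency is at most \<open>3 * D ^ 3\<close>, and 3 + 3 <
  8.\<close>

lemma sidon_less:
  assumes "i < D" "j < D" "D \<le> 2 ^ k"
  shows "sidon D i + sidon D j < 2 ^ (3 * k + 3)"
proof -
  have *: "sidon D i \<le> 3 * D ^ 3" if "i < D" for i
  proof -
    have "i * 1 \<le> D * D\<^sup>2" using that by (intro mult_mono) auto
    moreover have "2 * D * i\<^sup>2 \<le> 2 * D * D\<^sup>2" using that by (intro mult_le_mono2 power_mono) auto
    ultimately have "i + 2 * D * i\<^sup>2 \<le> D * D\<^sup>2 + 2 * D * D\<^sup>2" by linarith
    then show ?thesis by (simp add: sidon_def power2_eq_square power3_eq_cube)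
  qed
  have "D ^ 3 \<le> (2 ^ k) ^ 3" using assms by (intro power_mono) auto
  then have "D ^ 3 \<le> 2 ^ (3 * k)" by (simp add: power_mult[symmetric] mult.commute)
  moreover have "D ^ 3 > 0" using assms by simp
  ultimately have "6 * D ^ 3 < 8 * 2 ^ (3 * k)" by linarith
  then show ?thesis using *[OF assms(1)] *[OF assms(2)] by (simp add: power_add)
qed

lemma sidon_sum_eq:
  assumes "i < D" "j < D" "k < D" "l < D" and eq: "sidon D i + sidon D j = sidon D k + sidon D l"
  shows "i = k \<and> j = l \<or> i = l \<and> j = k"
proof -
  have e: "(i + j) + 2 * D * (i\<^sup>2 + j\<^sup>2) = (k + l) + 2 * D * (k\<^sup>2 + l\<^sup>2)"
    using eq by (simp add: sidon_def algebra_simps)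
  have lt: "i + j < 2 * D" "k + l < 2 * D" using assms by auto
  have "((i + j) + 2 * D * (i\<^sup>2 + j\<^sup>2)) mod (2 * D) = i + j"
    "((k + l) + 2 * D * (k\<^sup>2 + l\<^sup>2)) mod (2 * D) = k + l"
    using lt by simp_all
  then have s: "i + j = k + l" using e by simp
  with e assms have q: "i\<^sup>2 + j\<^sup>2 = k\<^sup>2 + l\<^sup>2" by simp
  \<comment> \<open>Over the integers, eliminating j from the two equations leaves the factorization
    \<open>(i - k) * (i - l) = 0\<close>.\<close>
  have "int j = int k + int l - int i" using s by linarith
  moreover have "(int i)\<^sup>2 + (int j)\<^sup>2 = (int k)\<^sup>2 + (int l)\<^sup>2"
    using q by (simp flip: of_nat_power of_nat_add)
  ultimately have "(int i)\<^sup>2 + (int k + int l - int i)\<^sup>2 - (int k)\<^sup>2 - (int l)\<^sup>2 = 0" by simp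
  also have "(int i)\<^sup>2 + (int k + int l - int i)\<^sup>2 - (int k)\<^sup>2 - (int l)\<^sup>2
      = 2 * ((int i - int k) * (int i - int l))"
    by (simp add: power2_eq_square algebra_simps)
  finally have "(int i - int k) * (int i - int l) = 0" by simp
  then have "i = k \<or> i = l" by simp
  then show ?thesis using s by auto
qed

lemma sidon_inj:
  assumes "i < D" "j < D" "sidon D i = sidon D j"
  shows "i = j"
  using sidon_sum_eq[of i D i j j] assms by auto

text \<open>Paley-Zygmund inequality at level 1/10: the fraction of large values is at least
  \<open>(9/10)\<^sup>2 / 2 = 81/200\<close>, which exceeds 2/5.\<close>

lemma card_small_values_le:
  fixes X :: "nat \<Rightarrow> real" and A :: real
  assumes A: "A > 0" and m1: "(\<Sum>b<q. X b) = real q * A" and m2: "(\<Sum>b<q. (X b)\<^sup>2) \<le> real q * (2 * A\<^sup>2)"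
  shows "real (card {b\<in>{..<q}. X b < A / 10}) \<le> 3 / 5 * real q"
proof -
  define N where "N = card {b\<in>{..<q}. \<not> X b < A / 10}"
  have split: "real (card {b\<in>{..<q}. X b < A / 10}) + real N = real q"
  proof -
    have "card ({b\<in>{..<q}. X b < A / 10} \<union> {b\<in>{..<q}. \<not> X b < A / 10}) =
       card {b\<in>{..<q}. X b < A / 10} + N" unfolding N_def by (intro card_Un_disjoint) auto
    moreover have "{b\<in>{..<q}. X b < A / 10} \<union> {b\<in>{..<q}. \<not> X b < A / 10} = {..<q}" by auto
    ultimately show ?thesis by simp
  qed
  \<comment> \<open>Cauchy-Schwarz in linearized form. The weights come from the AM-GM inequality
    \<open>9/10 * X \<le> (9/20 * X)\<^sup>2 / A + A\<close>, scaled by 10/9, on the large values;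
    on the small ones the first term suffices.\<close>
  have "X b \<le> A / 10 + 9 / 40 * (X b)\<^sup>2 / A + (if X b < A / 10 then 0 else 10 / 9 * A)" for b
  proof (cases "X b < A / 10")
    case True then show ?thesis using A by (auto intro: add_increasing2)
  next
    case False
    have "0 \<le> (9 / 20 * X b - A)\<^sup>2 / A" using A by simp
    also have "\<dots> = 81 / 400 * (X b)\<^sup>2 / A - 9 / 10 * X b + A"
      using A by (simp add: power2_diff field_simps power2_eq_square)
    finally have "9 / 10 * X b \<le> 81 / 400 * ((X b)\<^sup>2 / A) + A" by simp
    then show ?thesis using False A by simp
  qed
  then have "(\<Sum>b<q. X b) \<le> (\<Sum>b<q. A / 10 + 9 / 40 * (X b)\<^sup>2 / A + (if X b < A / 10 then 0 else 10 / 9 * A))"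
    by (intro sum_mono)
  also have "\<dots> = real q * (A / 10) + 9 / 40 * (\<Sum>b<q. (X b)\<^sup>2) / A + real N * (10 / 9 * A)"
    by (simp add: sum.distrib sum_distrib_left sum_divide_distrib N_def sum.If_cases Int_def)
  also have "(\<Sum>b<q. (X b)\<^sup>2) \<le> real q * (2 * A\<^sup>2)" by (rule m2)
  finally have "real q * A \<le> real q * (A / 10) + 9 / 40 * (real q * (2 * A\<^sup>2)) / A + real N * (10 / 9 * A)"
    using A m1 by (simp add: divide_right_mono)
  also have "\<dots> = (real q / 10 + 9 / 20 * real q + real N * (10 / 9)) * A"
    using A by (simp add: field_simps power2_eq_square)
  finally have "real q \<le> real q / 10 + 9 / 20 * real q + real N * (10 / 9)" using A by simp
  then show ?thesis using split by linarith
qed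

text \<open>Distinct frequencies make the mean of the squared modulus equal to the sum of squares A.
  The Sidon property bounds its second moment by \<open>2 * A\<^sup>2\<close>, as for a complex
  Gaussian: a sum of two frequencies arises only from one pair and its swap.\<close>

lemma card_small_sidon_polynomial_le:
  fixes a :: "nat \<Rightarrow> real"
  assumes D: "D \<le> 2 ^ k" and q: "q = 2 ^ (3 * k + 3)" and a: "(\<Sum>j<D. (a j)\<^sup>2) > 0"
  shows "real (card {b\<in>{..<q}. (cmod (\<Sum>j<D. of_real (a j) * cis (2 * pi * real b * real (sidon D j) / real q)))\<^sup>2
      < (\<Sum>j<D. (a j)\<^sup>2) / 10}) \<le> 3 / 5 * real q"
proof (rule card_small_values_le[OF a])
  let ?e = "\<lambda>b m. cis (2 * pi * real b * m / real q)"
  let ?f = "\<lambda>b. \<Sum>j<D. of_real (a j) * ?e b (real (sidon D j))"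
  have Hq: "sidon D i + sidon D j < q" if "i < D" "j < D" for i j
    using sidon_less[OF that D] q by simp
  then have H1: "sidon D i < q" if "i < D" for i using that by (meson add_lessD1)
  have "(\<Sum>b<q. (cmod (?f b))\<^sup>2) = real q * (\<Sum>i<D. \<Sum>j<D. if sidon D i = sidon D j then a i * a j else 0)"
    by (rule finite_parseval) (auto intro: H1)
  also have "(\<Sum>i<D. \<Sum>j<D. if sidon D i = sidon D j then a i * a j else 0) = (\<Sum>i<D. \<Sum>j<D. if i = j then a i * a j else 0)"
    by (intro sum.cong refl) (auto dest: sidon_inj)
  finally show "(\<Sum>b<q. (cmod (?f b))\<^sup>2) = real q * (\<Sum>j<D. (a j)\<^sup>2)" by (simp add: power2_eq_square)
  define c where "c = (\<lambda>(i, j). a i * a j)"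
  define H where "H = (\<lambda>(i, j). sidon D i + sidon D j)"
  let ?P = "{..<D} \<times> {..<D}"
  \<comment> \<open>The fourth power is the squared modulus of the squared polynomial, whose terms
    are indexed by pairs.\<close>
  have sq: "((cmod (?f b))\<^sup>2)\<^sup>2 = (cmod (\<Sum>p\<in>?P. of_real (c p) * ?e b (real (H p))))\<^sup>2" for b
  proof -
    have e0: "?e b (x + y) = ?e b x * ?e b y" for x y
      unfolding cis_mult by (simp add: add_divide_distrib algebra_simps)
    have e: "of_real (a i * a j) * ?e b (x + y) = (of_real (a i) * ?e b x) * (of_real (a j) * ?e b y)" for i j x y
      unfolding of_real_mult e0 by (simp only: mult_ac)
    have "?f b * ?f b = (\<Sum>p\<in>?P. of_real (c p) * ?e b (real (H p)))"
      unfolding sum_product sum.cartesian_product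
      by (intro sum.cong refl) (simp only: c_def H_def case_prod_unfold of_nat_add e)
    then show ?thesis by (simp add: power2_eq_square flip: norm_mult)
  qed
  have "(\<Sum>b<q. ((cmod (?f b))\<^sup>2)\<^sup>2) = real q * (\<Sum>p\<in>?P. \<Sum>r\<in>?P. if H p = H r then c p * c r else 0)"
    unfolding sq by (rule finite_parseval) (auto simp: H_def intro: Hq)
  \<comment> \<open>A pair on the diagonal equals its swap and is counted twice on the right, hence
    an inequality.\<close>
  also have "(\<Sum>p\<in>?P. \<Sum>r\<in>?P. if H p = H r then c p * c r else 0)
      \<le> (\<Sum>p\<in>?P. \<Sum>r\<in>?P. (if r = p then (c p)\<^sup>2 else 0) + (if r = prod.swap p then (c p)\<^sup>2 else 0))"
  proof (intro sum_mono)
    fix p r assume "p \<in> ?P" "r \<in> ?P"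
    then have "r = p \<or> r = prod.swap p" if "H p = H r"
      using that sidon_sum_eq[of "fst p" D "snd p" "fst r" "snd r"]
      by (cases p; cases r) (auto simp: H_def)
    moreover have "c (prod.swap p) = c p" by (simp add: c_def case_prod_unfold)
    moreover have "0 \<le> (c p)\<^sup>2" by simp
    ultimately show "(if H p = H r then c p * c r else 0) \<le> (if r = p then (c p)\<^sup>2 else 0) + (if r = prod.swap p then (c p)\<^sup>2 else 0)"
      unfolding power2_eq_square by (smt (verit, best))
  qed
  also have "\<dots> = (\<Sum>p\<in>?P. 2 * (c p)\<^sup>2)"
    by (intro sum.cong refl) (auto simp: sum.distrib)
  also have "\<dots> = 2 * (\<Sum>j<D. (a j)\<^sup>2)\<^sup>2"
    by (simp add: power2_eq_square sum_product sum.cartesian_product c_def sum_distrib_left case_prod_unfold mult_ac)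
  finally show "(\<Sum>b<q. ((cmod (?f b))\<^sup>2)\<^sup>2) \<le> real q * (2 * (\<Sum>j<D. (a j)\<^sup>2)\<^sup>2)"
    by (simp add: mult_left_mono)
qed

text \<open>Directions must be real, so real and imaginary parts of the exponentials are mixed by a
  multiplier: one of the parts has at least half of the squared modulus, whence 1/20 from 1/10.
  Since \<open>sidon D 0 = 0\<close>, entry 0 of the cosine vector is positive and that of the sine
  vector is 0, which meets the sign condition of \<open>spread_family_combine\<close>.\<close>

lemma spread_family_base:
  assumes D: "D \<le> 2 ^ k" "D \<ge> 1" and q: "q = 2 ^ (3 * k + 3)"
  shows "spread_family (3 / 5 + 1 / 1024) (1 / 20 / (64 * 1024 ^ 4)) D ({..<q} \<times> {..<1024})
    (\<lambda>(b, z) j. (cos (2 * pi * real b * real (sidon D j) / real q) / sqrt (real D)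
      + real (Suc z) * (sin (2 * pi * real b * real (sidon D j) / real q) / sqrt (real D))) / (2 * 1024))"
proof -
  let ?t = "\<lambda>b j. 2 * pi * real b * real (sidon D j) / real q"
  let ?v = "\<lambda>b j. cos (?t b j) / sqrt (real D)"
  let ?w = "\<lambda>b j. sin (?t b j) / sqrt (real D)"
  have le1: "(\<Sum>j<D. (g j / sqrt (real D))\<^sup>2) \<le> 1" if "\<And>j. \<bar>g j\<bar> \<le> 1" for g :: "nat \<Rightarrow> real"
  proof -
    have "(\<Sum>j<D. (g j / sqrt (real D))\<^sup>2) \<le> (\<Sum>j<D. 1 / real D)"
      using that D by (intro sum_mono) (auto simp: power_divide divide_right_mono abs_square_le_1)
    also have "\<dots> = 1" using D by simp
    finally show ?thesis .
  qed
  have "spread_family (3 / 5 + 1 / real 1024) (1 / 20 / (64 * real 1024 ^ 4)) D ({..<q} \<times> {..<1024})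
    (\<lambda>(b, z) j. (?v b j + real (Suc z) * ?w b j) / (2 * real 1024))"
  proof (rule spread_family_combine)
    fix a :: "nat \<Rightarrow> real"
    define A where "A = (\<Sum>j<D. (a j)\<^sup>2)"
    let ?B = "{z \<in> {..<q}. (\<Sum>j<D. ?v z j * a j)\<^sup>2 < 1 / 20 * A / real D \<and>
      (\<Sum>j<D. ?w z j * a j)\<^sup>2 < 1 / 20 * A / real D}"
    have "A \<ge> 0" by (simp add: A_def sum_nonneg)
    then consider "A = 0" | "A > 0" by linarith
    then have "real (card ?B) \<le> 3 / 5 * real q"
    proof cases
      case 1 
      then have "?B = {}" by simp
      then show ?thesis by (simp only: card.empty)
    next
      case 2
      let ?C = "{b\<in>{..<q}. (cmod (\<Sum>j<D. of_real (a j) * cis (?t b j)))\<^sup>2 < A / 10}"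
      have eq: "(\<Sum>j<D. ?v b j * a j)\<^sup>2 + (\<Sum>j<D. ?w b j * a j)\<^sup>2 =
         (cmod (\<Sum>j<D. of_real (a j) * cis (?t b j)))\<^sup>2 / real D" for b
      proof -
        have "(\<Sum>j<D. ?v b j * a j) = Re (\<Sum>j<D. of_real (a j) * cis (?t b j)) / sqrt (real D)"
          by (simp add: sum_divide_distrib mult_ac)
        moreover have "(\<Sum>j<D. ?w b j * a j) = Im (\<Sum>j<D. of_real (a j) * cis (?t b j)) / sqrt (real D)"
          by (simp add: sum_divide_distrib mult_ac)
        ultimately show ?thesis unfolding cmod_power2 by (simp add: power_divide add_divide_distrib)
      qed
      have "?B \<subseteq> ?C"
      proof
        fix b assume b: "b \<in> ?B"
        then have "(cmod (\<Sum>j<D. of_real (a j) * cis (?t b j)))\<^sup>2 / real D < A / 10 / real D"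
          unfolding eq[symmetric] by simp
        then have "(cmod (\<Sum>j<D. of_real (a j) * cis (?t b j)))\<^sup>2 < A / 10"
          using D by (simp only: divide_less_cancel)
        then show "b \<in> ?C" using b by simp
      qed
      then have "card ?B \<le> card ?C" by (intro card_mono) auto
      also have "real (card ?C) \<le> 3 / 5 * real q"
        using card_small_sidon_polynomial_le[OF D(1) q] 2 unfolding A_def by blast
      finally show ?thesis by simp
    qed
    then show "real (card {z \<in> {..<q}. (\<Sum>j<D. ?v z j * a j)\<^sup>2 < 1 / 20 * (\<Sum>j<D. (a j)\<^sup>2) / real D \<and>
      (\<Sum>j<D. ?w z j * a j)\<^sup>2 < 1 / 20 * (\<Sum>j<D. (a j)\<^sup>2) / real D}) \<le> 3 / 5 * real (card {..<q})"
      by (simp add: A_def)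
  qed (use D in \<open>auto simp: sidon_def intro!: le1\<close>)
  then show ?thesis by simp
qed

section \<open>Amplification to failure probability 1/40 with O(ln D) seed bits\<close>

lemma spread_family_mono:
  assumes "spread_family p \<delta> D S u" "p \<le> p'"
  shows "spread_family p' \<delta> D S u"
  using assms unfolding spread_family_def
  by (meson mult_right_mono of_nat_0_le_iff order_trans)

lemma card_bits: "card (bits s) = 2 ^ s"
  using card_lists_length_eq[of "UNIV :: bool set" s] by (simp add: bits_def)

lemma spread_family_exists:
  "\<exists>\<delta> > 0. \<delta> \<le> 1 \<and> (\<forall>D s. D \<ge> 1 \<longrightarrow> 200 * (1 + ln (real D)) \<le> real s \<longrightarrow>
     (\<exists>u. spread_family (1 / 40) \<delta> D (bits s) u))"
proof -
  define next' :: "real \<Rightarrow> real" where "next' \<delta> = \<delta> / (64 * real 1024 ^ 4)" for \<delta>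
  have next_pos: "\<delta> > 0 \<Longrightarrow> next' \<delta> > 0" for \<delta> by (simp add: next'_def)
  have next_le: "next' \<delta> \<le> 1" if "\<delta> > 0" "\<delta> \<le> 1" for \<delta> using that by (simp add: next'_def)
  define \<delta>0 :: real where "\<delta>0 = 1 / 20 / (64 * 1024 ^ 4)"
  have \<delta>0: "\<delta>0 > 0" "\<delta>0 \<le> 1" by (simp_all add: \<delta>0_def)
  have "\<exists>u. spread_family (1 / 40) (next' (next' (next' \<delta>0))) D (bits s) u"
    if D: "D \<ge> 1" and s: "200 * (1 + ln (real D)) \<le> real s" for D s
  proof -
    \<comment> \<open>D is rounded up to \<open>2 ^ (n + 1)\<close>, so that every sample set has a
      power of two as its cardinality and can be matched with bit strings.\<close>
    obtain n where n: "2 ^ n \<le> D" "D < 2 ^ (n + 1)"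
      using ex_power_ivl1[of 2 D] D by auto
    define S0 where "S0 = {..<2 ^ (3 * (n + 1) + 3) :: nat} \<times> {..<1024 :: nat}"
    define S1 where "S1 = (S0 \<times> S0) \<times> {..<1024 :: nat}"
    define S2 where "S2 = (S1 \<times> S1) \<times> {..<1024 :: nat}"
    define S3 where "S3 = (S2 \<times> S2) \<times> {..<1024 :: nat}"
    have k: "(1024 :: nat) = 2 ^ 10" by simp
    \<comment> \<open>The exponents are 3 n + 16, 6 n + 42, 12 n + 94 and 24 n + 198: each stage
      doubles and adds the 10 bits of a multiplier.\<close>
    have c: "card S3 = 2 ^ (24 * n + 198)"
      unfolding S3_def S2_def S1_def S0_def card_cartesian_product card_lessThan k power_add[symmetric]
      by (rule arg_cong[where f="(^) 2"]) simp
    define p :: real where "p = 3 / 5 + 1 / 1024"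
    define z :: real where "z = 1 / real 1024"
    obtain u0 where u0: "spread_family p \<delta>0 D S0 u0"
      using spread_family_base[OF less_imp_le[OF n(2)] D refl] unfolding S0_def p_def \<delta>0_def by blast
    obtain u1 where u1: "spread_family (p\<^sup>2 + z) (next' \<delta>0) D S1 u1"
      using spread_family_double[OF u0 _ D \<delta>0(1), of 1024] unfolding S1_def next'_def z_def by auto
    obtain u2 where u2: "spread_family ((p\<^sup>2 + z)\<^sup>2 + z) (next' (next' \<delta>0)) D S2 u2"
      using spread_family_double[OF u1 _ D, of 1024] next_pos \<delta>0 unfolding S2_def next'_def z_def by auto
    obtain u3 where u3: "spread_family (((p\<^sup>2 + z)\<^sup>2 + z)\<^sup>2 + z) (next' (next' (next' \<delta>0))) D S3 u3"
      using spread_family_double[OF u2 _ D, of 1024] next_pos \<delta>0 unfolding S3_def next'_def z_def by auto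
    \<comment> \<open>The failure probability falls from about 0.601 to 0.362, 0.132 and 0.018, so
      1/40 takes three doublings.\<close>
    have "((p\<^sup>2 + z)\<^sup>2 + z)\<^sup>2 + z \<le> 1 / 40"
      by (simp add: p_def z_def power2_eq_square)
    with u3 have u3': "spread_family (1 / 40) (next' (next' (next' \<delta>0))) D S3 u3"
      by (rule spread_family_mono)
    \<comment> \<open>From \<open>n / 2 \<le> ln D\<close>, 24 n is at most 48 ln D, and the factor
      200 covers both 48 and 198.\<close>
    have "real (24 * n + 198) \<le> real s"
    proof -
      have "ln (2 ^ n) \<le> ln (real D)" using n(1) D by (subst ln_le_cancel_iff) (auto simp flip: of_nat_le_iff)
      moreover have "ln (2 ^ n) = real n * ln (2 :: real)" by (simp add: ln_realpow)
      moreover have "real n * (1 / 2) \<le> real n * ln 2" using ln2_ge_two_thirds by (intro mult_left_mono) auto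
      moreover have "ln (real D) \<ge> 0" using D by simp
      ultimately show ?thesis using s by simp
    qed
    then have s': "s = 24 * n + 198 + (s - (24 * n + 198))" by linarith
    \<comment> \<open>The surplus seed bits form a factor that the family ignores.\<close>
    have "card (bits s) = card (S3 \<times> {..<2 ^ (s - (24 * n + 198)) :: nat})"
      unfolding card_bits card_cartesian_product c card_lessThan power_add[symmetric] using s' by simp
    then obtain f where "bij_betw f (bits s) (S3 \<times> {..<2 ^ (s - (24 * n + 198)) :: nat})"
      using finite_same_card_bij[OF finite_bits, of "S3 \<times> {..<2 ^ (s - (24 * n + 198)) :: nat}" s] u3
      by (auto simp: spread_family_def)
    from spread_family_reindex[OF spread_family_times[OF u3'] this] show ?thesis by auto
  qed
  then show ?thesis using \<delta>0 next_pos next_le by (intro exI[of _ "next' (next' (next' \<delta>0))"]) auto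
qed

text \<open>Scalar anti-concentration is lifted to blocks of coordinates by Markov's inequality for the total weight
  of the blocks on which the scalar bound fails.\<close>
lemma spread_family_blocks:
  fixes l :: nat
  assumes u: "spread_family p \<delta> D S u" and W: "0 < (\<Sum>g<l. w g)" and w: "\<And>g. 0 \<le> (w g :: real)"
  shows "real (card {z\<in>S. (\<Sum>g | g < l \<and> (\<Sum>j<D. u z j * a g j)\<^sup>2 \<ge> \<delta> * (\<Sum>j<D. (a g j)\<^sup>2) / real D. w g)
      < (\<Sum>g<l. w g) / 2}) \<le> 2 * p * real (card S)"
proof -
  define B where "B g = {z\<in>S. (\<Sum>j<D. u z j * a g j)\<^sup>2 < \<delta> * (\<Sum>j<D. (a g j)\<^sup>2) / real D}" for g
  define W where "W = (\<Sum>g<l. w g)"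
  let ?good = "\<lambda>z. {g. g < l \<and> (\<Sum>j<D. u z j * a g j)\<^sup>2 \<ge> \<delta> * (\<Sum>j<D. (a g j)\<^sup>2) / real D}"
  let ?C = "{z\<in>S. sum w (?good z) < W / 2}"
  have S: "finite S" using u by (simp add: spread_family_def)
  have "real (card ?C) * (W / 2) = (\<Sum>z\<in>?C. W / 2)" by simp
  also have "\<dots> \<le> (\<Sum>z\<in>?C. \<Sum>g<l. if z \<in> B g then w g else 0)"
  proof (rule sum_mono)
    fix z assume z: "z \<in> ?C"
    have "(\<Sum>g<l. if z \<in> B g then w g else 0) + sum w (?good z)
        = (\<Sum>g<l. (if z \<in> B g then w g else 0) + (if z \<notin> B g then w g else 0))"
    proof -
      have "sum w (?good z) = (\<Sum>g\<in>{..<l} \<inter> {g. z \<notin> B g}. w g)"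
        using z by (intro sum.cong) (auto simp: B_def not_less)
      also have "\<dots> = (\<Sum>g<l. if z \<notin> B g then w g else 0)"
        using sum.inter_restrict[OF finite_lessThan, where g=w and B="{g. z \<notin> B g}"] by simp
      finally show ?thesis by (simp add: sum.distrib)
    qed
    also have "\<dots> = W" unfolding W_def by (intro sum.cong) auto
    finally show "W / 2 \<le> (\<Sum>g<l. if z \<in> B g then w g else 0)" using z by simp
  qed
  also have "\<dots> \<le> (\<Sum>z\<in>S. \<Sum>g<l. if z \<in> B g then w g else 0)"
    using S w by (intro sum_mono2) (auto intro!: sum_nonneg)
  also have "\<dots> = (\<Sum>g<l. \<Sum>z\<in>S. if z \<in> B g then w g else 0)" by (rule sum.swap)
  also have "\<dots> = (\<Sum>g<l. w g * real (card (B g)))"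
  proof (rule sum.cong[OF refl])
    fix g
    have "S \<inter> {z. z \<in> B g} = B g" by (auto simp: B_def)
    then show "(\<Sum>z\<in>S. if z \<in> B g then w g else 0) = w g * real (card (B g))"
      using S by (simp add: sum.If_cases)
  qed
  also have "\<dots> \<le> (\<Sum>g<l. w g * (p * real (card S)))"
    using u w by (intro sum_mono mult_left_mono) (auto simp: B_def spread_family_def)
  also have "\<dots> = W * (p * real (card S))" by (simp add: W_def sum_distrib_right)
  finally have "real (card ?C) * W \<le> (2 * p * real (card S)) * W" by (simp only: mult_ac)
  then show ?thesis using assms(2) unfolding W_def by (simp only: mult_le_cancel_right)
qed

subsection \<open>Moments of the pair-agreement statistic\<close>

context prob_space
begin

lemma integrable_bounded_rv:
  fixes X :: "'a \<Rightarrow> real"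
  assumes "X \<in> borel_measurable M" "\<And>\<omega>. \<omega> \<in> space M \<Longrightarrow> \<bar>X \<omega>\<bar> \<le> B"
  shows "integrable M X"
  using assms by (intro integrable_const_bound[of _ B]) auto

lemma expectation_indep_power_mult:
  fixes X Y :: "'a \<Rightarrow> real"
  assumes ind: "indep_var borel X borel Y"
    and X: "\<And>\<omega>. \<omega> \<in> space M \<Longrightarrow> \<bar>X \<omega>\<bar> \<le> B" and Y: "\<And>\<omega>. \<omega> \<in> space M \<Longrightarrow> \<bar>Y \<omega>\<bar> \<le> C"
  shows "integrable M (\<lambda>\<omega>. X \<omega> ^ a * Y \<omega> ^ b)"
    and "expectation (\<lambda>\<omega>. X \<omega> ^ a * Y \<omega> ^ b) = expectation (\<lambda>\<omega>. X \<omega> ^ a) * expectation (\<lambda>\<omega>. Y \<omega> ^ b)"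
proof -
  have [measurable]: "X \<in> borel_measurable M" "Y \<in> borel_measurable M"
    using ind by (auto dest: indep_var_rv1 indep_var_rv2)
  have i: "integrable M (\<lambda>\<omega>. X \<omega> ^ a)" "integrable M (\<lambda>\<omega>. Y \<omega> ^ b)"
    using X Y by (auto intro!: integrable_bounded_rv[where B="B ^ a" and X="\<lambda>\<omega>. X \<omega> ^ a"]
        integrable_bounded_rv[where B="C ^ b" and X="\<lambda>\<omega>. Y \<omega> ^ b"] power_mono simp: power_abs)
  have "indep_var borel ((\<lambda>x. x ^ a) \<circ> X) borel ((\<lambda>x. x ^ b) \<circ> Y)"
    by (rule indep_var_compose[OF ind]) auto
  then have *: "indep_var borel (\<lambda>\<omega>. X \<omega> ^ a) borel (\<lambda>\<omega>. Y \<omega> ^ b)" by (simp add: comp_def)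
  show "integrable M (\<lambda>\<omega>. X \<omega> ^ a * Y \<omega> ^ b)" by (rule indep_var_integrable[OF * i])
  show "expectation (\<lambda>\<omega>. X \<omega> ^ a * Y \<omega> ^ b) = expectation (\<lambda>\<omega>. X \<omega> ^ a) * expectation (\<lambda>\<omega>. Y \<omega> ^ b)"
    by (rule indep_var_lebesgue_integral[OF * i])
qed

lemma second_moment_sum_indep_centred:
  fixes \<xi> :: "'i \<Rightarrow> 'a \<Rightarrow> real"
  assumes "finite K" and "indep_vars (\<lambda>_. borel) \<xi> K"
    and "\<And>k \<omega>. k \<in> K \<Longrightarrow> \<omega> \<in> space M \<Longrightarrow> \<bar>\<xi> k \<omega>\<bar> \<le> B"
    and "\<And>k. k \<in> K \<Longrightarrow> expectation (\<xi> k) = 0"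
  shows "expectation (\<lambda>\<omega>. (\<Sum>k\<in>K. \<xi> k \<omega>)\<^sup>2) = (\<Sum>k\<in>K. expectation (\<lambda>\<omega>. (\<xi> k \<omega>)\<^sup>2))"
  using assms
proof (induction K rule: finite_induct)
  case (insert i K)
  define R where "R \<omega> = (\<Sum>k\<in>K. \<xi> k \<omega>)" for \<omega>
  have ind: "indep_var borel (\<xi> i) borel R"
    using indep_vars_sum[OF insert.hyps insert.prems(1)] by (simp add: R_def[abs_def])
  have bR: "\<bar>R \<omega>\<bar> \<le> real (card K) * B" if "\<omega> \<in> space M" for \<omega>
    unfolding R_def using insert.prems(2) that by (intro order_trans[OF sum_abs] sum_bounded_above) auto
  note mixed = expectation_indep_power_mult[OF ind insert.prems(2)[OF insertI1] bR]
  define J where "J a b \<omega> = \<xi> i \<omega> ^ a * R \<omega> ^ b" for a b \<omega>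
  have J: "integrable M (J a b)" "expectation (J a b) = expectation (\<lambda>\<omega>. \<xi> i \<omega> ^ a) * expectation (\<lambda>\<omega>. R \<omega> ^ b)" for a b
    unfolding J_def[abs_def] using mixed by auto
  have "expectation (\<lambda>\<omega>. (\<Sum>k\<in>insert i K. \<xi> k \<omega>)\<^sup>2) = expectation (\<lambda>\<omega>. J 0 2 \<omega> + 2 * J 1 1 \<omega> + J 2 0 \<omega>)"
    using insert.hyps
    by (intro Bochner_Integration.integral_cong refl) (simp add: J_def R_def power2_eq_square algebra_simps)
  also have "\<dots> = expectation (J 0 2) + 2 * expectation (J 1 1) + expectation (J 2 0)"
    using J(1) by simp
  also have "\<dots> = expectation (\<lambda>\<omega>. (R \<omega>)\<^sup>2) + expectation (\<lambda>\<omega>. (\<xi> i \<omega>)\<^sup>2)"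
    unfolding J(2) using insert.prems(3)[of i] by (simp add: prob_space)
  also have "expectation (\<lambda>\<omega>. (R \<omega>)\<^sup>2) = (\<Sum>k\<in>K. expectation (\<lambda>\<omega>. (\<xi> k \<omega>)\<^sup>2))"
    unfolding R_def using insert.prems by (intro insert.IH indep_vars_subset[OF insert.prems(1)]) auto
  finally show ?case using insert.hyps by simp
qed simp

text \<open>By induction: the odd cross terms vanish by centring and the middle one is at most 6 n,
  so the bound passes on because \<open>4 * n\<^sup>2 + 6 * n + 4 \<le> 4 * (n + 1)\<^sup>2\<close>.
  A bound of order \<open>n\<^sup>2\<close>, not \<open>n ^ 4\<close>, keeps the noise of the pair
  statistic at order n.\<close>

lemma fourth_moment_sum_indep_centred:
  fixes \<xi> :: "'i \<Rightarrow> 'a \<Rightarrow> real"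
  assumes "finite K" and "indep_vars (\<lambda>_. borel) \<xi> K"
    and "\<And>k \<omega>. k \<in> K \<Longrightarrow> \<omega> \<in> space M \<Longrightarrow> \<bar>\<xi> k \<omega>\<bar> \<le> 2"
    and "\<And>k. k \<in> K \<Longrightarrow> expectation (\<xi> k) = 0"
    and "\<And>k. k \<in> K \<Longrightarrow> expectation (\<lambda>\<omega>. (\<xi> k \<omega>)\<^sup>2) \<le> 1"
  shows "expectation (\<lambda>\<omega>. (\<Sum>k\<in>K. \<xi> k \<omega>) ^ 4) \<le> 4 * (real (card K))\<^sup>2"
  using assms
proof (induction K rule: finite_induct)
  case (insert i K)
  define R where "R \<omega> = (\<Sum>k\<in>K. \<xi> k \<omega>)" for \<omega>
  have ind: "indep_var borel (\<xi> i) borel R"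
    using indep_vars_sum[OF insert.hyps insert.prems(1)] by (simp add: R_def[abs_def])
  have ind': "indep_vars (\<lambda>_. borel) \<xi> K" by (rule indep_vars_subset[OF insert.prems(1)]) auto
  have bR: "\<bar>R \<omega>\<bar> \<le> real (card K) * 2" if "\<omega> \<in> space M" for \<omega>
    unfolding R_def using insert.prems(2) that by (intro order_trans[OF sum_abs] sum_bounded_above) auto
  note mixed = expectation_indep_power_mult[OF ind insert.prems(2)[OF insertI1] bR]
  have [measurable]: "\<xi> i \<in> borel_measurable M" using ind by (rule indep_var_rv1)
  have int: "integrable M (\<lambda>\<omega>. \<xi> i \<omega> ^ a * R \<omega> ^ b)" for a b by (rule mixed(1))
  have ER: "expectation R = 0"
    unfolding R_def using insert.prems ind'
    by (subst Bochner_Integration.integral_sum)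
      (auto intro!: integrable_bounded_rv[where B=2] simp: indep_vars_def)
  have ER2: "expectation (\<lambda>\<omega>. (R \<omega>)\<^sup>2) \<le> real (card K)"
  proof -
    have "expectation (\<lambda>\<omega>. (R \<omega>)\<^sup>2) = (\<Sum>k\<in>K. expectation (\<lambda>\<omega>. (\<xi> k \<omega>)\<^sup>2))"
      unfolding R_def by (rule second_moment_sum_indep_centred[OF insert.hyps(1) ind' insert.prems(2,3)]) auto
    also have "\<dots> \<le> (\<Sum>k\<in>K. 1)" by (intro sum_mono insert.prems(4)) auto
    finally show ?thesis by simp
  qed
  have E4: "expectation (\<lambda>\<omega>. \<xi> i \<omega> ^ 4) \<le> 4"
  proof -
    have "expectation (\<lambda>\<omega>. \<xi> i \<omega> ^ 4) \<le> expectation (\<lambda>\<omega>. 4 * (\<xi> i \<omega>)\<^sup>2)"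
    proof (rule integral_mono)
      show "integrable M (\<lambda>\<omega>. \<xi> i \<omega> ^ 4)" "integrable M (\<lambda>\<omega>. 4 * (\<xi> i \<omega>)\<^sup>2)"
        using int[of 4 0] int[of 2 0] by auto
      fix \<omega> assume "\<omega> \<in> space M"
      then have "(\<xi> i \<omega>)\<^sup>2 \<le> 2\<^sup>2" using insert.prems(2)[of i \<omega>] by (intro abs_le_square_iff[THEN iffD1]) auto
      then have "(\<xi> i \<omega>)\<^sup>2 * (\<xi> i \<omega>)\<^sup>2 \<le> 4 * (\<xi> i \<omega>)\<^sup>2" by (intro mult_right_mono) auto
      then show "\<xi> i \<omega> ^ 4 \<le> 4 * (\<xi> i \<omega>)\<^sup>2" by (simp add: power2_eq_square power4_eq_xxxx)
    qed
    also have "\<dots> \<le> 4" using insert.prems(4)[of i] by simp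
    finally show ?thesis .
  qed
  have E2: "0 \<le> expectation (\<lambda>\<omega>. (\<xi> i \<omega>)\<^sup>2)" "expectation (\<lambda>\<omega>. (\<xi> i \<omega>)\<^sup>2) \<le> 1"
    using insert.prems(4)[of i] by auto
  define J where "J a b \<omega> = \<xi> i \<omega> ^ a * R \<omega> ^ b" for a b \<omega>
  have J: "integrable M (J a b)" "expectation (J a b) = expectation (\<lambda>\<omega>. \<xi> i \<omega> ^ a) * expectation (\<lambda>\<omega>. R \<omega> ^ b)" for a b
    unfolding J_def[abs_def] using mixed by auto
  have "expectation (\<lambda>\<omega>. (\<Sum>k\<in>insert i K. \<xi> k \<omega>) ^ 4)
      = expectation (\<lambda>\<omega>. J 0 4 \<omega> + 4 * J 1 3 \<omega> + 6 * J 2 2 \<omega> + 4 * J 3 1 \<omega> + J 4 0 \<omega>)"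
    using insert.hyps
    by (intro Bochner_Integration.integral_cong refl)
      (simp add: J_def R_def power2_eq_square power3_eq_cube power4_eq_xxxx algebra_simps)
  also have "\<dots> = expectation (J 0 4) + 4 * expectation (J 1 3) + 6 * expectation (J 2 2)
      + 4 * expectation (J 3 1) + expectation (J 4 0)"
    using J(1) by simp
  also have "\<dots> = expectation (\<lambda>\<omega>. R \<omega> ^ 4) + 6 * (expectation (\<lambda>\<omega>. (\<xi> i \<omega>)\<^sup>2) * expectation (\<lambda>\<omega>. (R \<omega>)\<^sup>2))
      + expectation (\<lambda>\<omega>. \<xi> i \<omega> ^ 4)"
    unfolding J(2) using insert.prems(3)[of i] ER by (simp add: prob_space)
  also have "\<dots> \<le> 4 * (real (card K))\<^sup>2 + 6 * (1 * real (card K)) + 4"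
    using insert.IH[OF ind' insert.prems(2-4)] E2 ER2 E4 unfolding R_def[symmetric]
    by (intro add_mono mult_left_mono mult_mono) auto
  also have "\<dots> \<le> 4 * (real (card (insert i K)))\<^sup>2"
    using insert.hyps by (simp add: power2_eq_square algebra_simps)
  finally show ?case .
qed simp

text \<open>The shape of the variance bound, which is linear in the mean, makes one computation serve the null hypothesis
  (mean \<open>0\<close>) and the alternatives.\<close>
lemma collision_statistic_moments:
  fixes Y :: "'i \<Rightarrow> 'a \<Rightarrow> real"
  assumes K: "finite K" and ind: "indep_vars (\<lambda>_. borel) Y K"
    and pm: "\<And>k \<omega>. k \<in> K \<Longrightarrow> \<omega> \<in> space M \<Longrightarrow> (Y k \<omega>)\<^sup>2 = 1"
    and mean: "\<And>k. k \<in> K \<Longrightarrow> expectation (Y k) = p k"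
  defines "W \<equiv> \<lambda>\<omega>. (\<Sum>k\<in>K. Y k \<omega>)\<^sup>2 - real (card K)"
    and "e \<equiv> (\<Sum>k\<in>K. p k)\<^sup>2 - (\<Sum>k\<in>K. (p k)\<^sup>2)"
  shows "expectation W = e"
    and "expectation (\<lambda>\<omega>. (W \<omega> - e)\<^sup>2) \<le> 16 * (real (card K))\<^sup>2 + 8 * real (card K) * e"
    and "integrable M (\<lambda>\<omega>. (W \<omega> - e)\<^sup>2)" and "W \<in> borel_measurable M"
    and "\<And>\<omega>. \<omega> \<in> space M \<Longrightarrow> \<bar>W \<omega>\<bar> \<le> 2 * (real (card K))\<^sup>2"
proof -
  define n where "n = real (card K)"
  define P where "P = (\<Sum>k\<in>K. p k)"
  define \<xi> where "\<xi> k \<omega> = Y k \<omega> - p k" for k \<omega>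
  define R where "R \<omega> = (\<Sum>k\<in>K. \<xi> k \<omega>)" for \<omega>
  have Ym: "Y k \<in> borel_measurable M" if "k \<in> K" for k using ind that by (auto simp: indep_vars_def)
  have Yb: "\<bar>Y k \<omega>\<bar> = 1" if "k \<in> K" "\<omega> \<in> space M" for k \<omega>
    using pm[OF that] by (simp add: power2_eq_1_iff) (metis abs_1 abs_minus_cancel)
  have Yi: "integrable M (Y k)" if "k \<in> K" for k
    using that Ym Yb by (intro integrable_bounded_rv[where B=1]) auto
  have pb: "\<bar>p k\<bar> \<le> 1" if "k \<in> K" for k
  proof -
    have "\<bar>p k\<bar> \<le> expectation (\<lambda>\<omega>. \<bar>Y k \<omega>\<bar>)" unfolding mean[OF that, symmetric] by (rule integral_abs_bound)
    also have "\<dots> = expectation (\<lambda>\<omega>. 1)" using Yb that by (intro Bochner_Integration.integral_cong) auto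
    finally show ?thesis by (simp add: prob_space)
  qed
  have \<xi>ind: "indep_vars (\<lambda>_. borel) \<xi> K"
    unfolding \<xi>_def[abs_def] by (rule indep_vars_compose2[OF ind]) auto
  have \<xi>b: "\<bar>\<xi> k \<omega>\<bar> \<le> 2" if "k \<in> K" "\<omega> \<in> space M" for k \<omega>
    using Yb[OF that] pb[OF that(1)] by (simp add: \<xi>_def)
  have \<xi>0: "expectation (\<xi> k) = 0" if "k \<in> K" for k
    using mean[OF that] Yi[OF that] by (simp add: \<xi>_def[abs_def] prob_space)
  have \<xi>2: "expectation (\<lambda>\<omega>. (\<xi> k \<omega>)\<^sup>2) = 1 - (p k)\<^sup>2" if "k \<in> K" for k
  proof -
    have "expectation (\<lambda>\<omega>. (\<xi> k \<omega>)\<^sup>2) = expectation (\<lambda>\<omega>. 1 + (p k)\<^sup>2 - 2 * p k * Y k \<omega>)"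
      using pm[OF that] by (intro Bochner_Integration.integral_cong) (auto simp: \<xi>_def power2_diff)
    then show ?thesis using mean[OF that] Yi[OF that] by (simp add: prob_space power2_eq_square)
  qed
  have Rm [measurable]: "R \<in> borel_measurable M"
    unfolding R_def[abs_def] \<xi>_def using Ym by (intro borel_measurable_sum) auto
  have Rb: "\<bar>R \<omega>\<bar> \<le> n * 2" if "\<omega> \<in> space M" for \<omega>
    unfolding R_def n_def using \<xi>b that by (intro order_trans[OF sum_abs] sum_bounded_above) auto
  have Ri: "integrable M (\<lambda>\<omega>. R \<omega> ^ a)" for a
    using Rb power_mono[of "\<bar>R _\<bar>" "n * 2" a]
    by (intro integrable_bounded_rv[where B="(n * 2) ^ a"]) (auto simp: power_abs)
  have ER: "expectation R = 0"
    unfolding R_def using \<xi>0 by (subst Bochner_Integration.integral_sum) (auto simp: \<xi>_def[abs_def] Yi)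
  have ER2: "expectation (\<lambda>\<omega>. (R \<omega>)\<^sup>2) = n - (\<Sum>k\<in>K. (p k)\<^sup>2)"
    unfolding R_def using \<xi>2
    by (subst second_moment_sum_indep_centred[OF K \<xi>ind \<xi>b \<xi>0]) (auto simp: n_def sum_subtractf)
  have ER4: "expectation (\<lambda>\<omega>. R \<omega> ^ 4) \<le> 4 * n\<^sup>2"
    unfolding R_def n_def using \<xi>2 by (intro fourth_moment_sum_indep_centred K \<xi>ind \<xi>b \<xi>0) auto
  \<comment> \<open>Centring splits the statistic into a quadratic noise, a linear noise
    proportional to the total bias P, and a constant.\<close>
  have W: "W \<omega> = (R \<omega>)\<^sup>2 + 2 * P * R \<omega> + P\<^sup>2 - n" for \<omega>
  proof -
    have "(\<Sum>k\<in>K. Y k \<omega>) = R \<omega> + P" by (simp add: R_def \<xi>_def P_def sum_subtractf)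
    then show ?thesis by (simp add: W_def n_def power2_sum)
  qed
  show Wm: "W \<in> borel_measurable M" unfolding W by measurable
  have Ri1: "integrable M R" using Ri[of 1] by simp
  show EW: "expectation W = e"
    unfolding W using Ri[of 2] Ri1 ER ER2 by (simp add: prob_space e_def P_def)
  show Wb: "\<bar>W \<omega>\<bar> \<le> 2 * (real (card K))\<^sup>2" if "\<omega> \<in> space M" for \<omega>
  proof -
    have "\<bar>\<Sum>k\<in>K. Y k \<omega>\<bar> \<le> (\<Sum>k\<in>K. \<bar>Y k \<omega>\<bar>)" by (rule sum_abs)
    also have "\<dots> = n" using Yb that by (simp add: n_def)
    finally have "(\<Sum>k\<in>K. Y k \<omega>)\<^sup>2 \<le> n\<^sup>2" by (intro abs_le_square_iff[THEN iffD1]) (auto simp: n_def)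
    moreover have "0 \<le> (\<Sum>k\<in>K. Y k \<omega>)\<^sup>2" by simp
    moreover have "n \<le> n\<^sup>2" "0 \<le> n" unfolding n_def power2_eq_square of_nat_mult[symmetric] of_nat_le_iff by auto
    ultimately show ?thesis unfolding W_def n_def[symmetric] by linarith
  qed
  define v where "v = expectation (\<lambda>\<omega>. (R \<omega>)\<^sup>2)"
  have e: "e = P\<^sup>2 + v - n" unfolding v_def ER2 by (simp add: e_def P_def)
  have dev: "(W \<omega> - e)\<^sup>2 \<le> 2 * R \<omega> ^ 4 - 4 * v * (R \<omega>)\<^sup>2 + 2 * v\<^sup>2 + 8 * P\<^sup>2 * (R \<omega>)\<^sup>2" for \<omega>
  proof -
    have "W \<omega> - e = ((R \<omega>)\<^sup>2 - v) + 2 * P * R \<omega>" by (simp add: W e)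
    then have "(W \<omega> - e)\<^sup>2 = (((R \<omega>)\<^sup>2 - v) + 2 * P * R \<omega>)\<^sup>2" by (simp only:)
    also have "\<dots> \<le> 2 * ((R \<omega>)\<^sup>2 - v)\<^sup>2 + 2 * (2 * P * R \<omega>)\<^sup>2"
      using sum_squares_bound[of "(R \<omega>)\<^sup>2 - v" "2 * P * R \<omega>"] by (simp add: power2_sum)
    also have "\<dots> = 2 * R \<omega> ^ 4 - 4 * v * (R \<omega>)\<^sup>2 + 2 * v\<^sup>2 + 8 * P\<^sup>2 * (R \<omega>)\<^sup>2"
      by (simp add: power2_eq_square power4_eq_xxxx algebra_simps)
    finally show ?thesis .
  qed
  show int: "integrable M (\<lambda>\<omega>. (W \<omega> - e)\<^sup>2)"
  proof (rule integrable_bounded_rv[where B="(2 * (real (card K))\<^sup>2 + \<bar>e\<bar>)\<^sup>2"])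
    fix \<omega> assume "\<omega> \<in> space M"
    then have "\<bar>W \<omega> - e\<bar> \<le> 2 * (real (card K))\<^sup>2 + \<bar>e\<bar>" using Wb[of \<omega>] by linarith
    then have "(W \<omega> - e)\<^sup>2 \<le> (2 * (real (card K))\<^sup>2 + \<bar>e\<bar>)\<^sup>2"
      by (intro abs_le_square_iff[THEN iffD1]) auto
    then show "\<bar>(W \<omega> - e)\<^sup>2\<bar> \<le> (2 * (real (card K))\<^sup>2 + \<bar>e\<bar>)\<^sup>2" by simp
  qed (use Wm in measurable)
  have "expectation (\<lambda>\<omega>. (W \<omega> - e)\<^sup>2) \<le>
      expectation (\<lambda>\<omega>. 2 * R \<omega> ^ 4 - 4 * v * (R \<omega>)\<^sup>2 + 2 * v\<^sup>2 + 8 * P\<^sup>2 * (R \<omega>)\<^sup>2)"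
    using int Ri by (intro integral_mono dev) auto
  also have "\<dots> = 2 * expectation (\<lambda>\<omega>. R \<omega> ^ 4) - 2 * v\<^sup>2 + 8 * P\<^sup>2 * v"
    using Ri by (simp add: prob_space v_def[symmetric]) (simp add: power2_eq_square)
  also have "\<dots> \<le> 8 * n\<^sup>2 + 8 * P\<^sup>2 * n"
  proof -
    have "v \<le> n" unfolding v_def ER2 by (simp add: sum_nonneg)
    then have "8 * P\<^sup>2 * v \<le> 8 * P\<^sup>2 * n" by (intro mult_left_mono) auto
    then show ?thesis using ER4 zero_le_power2[of v] by linarith
  qed
  \<comment> \<open>The identity \<open>P\<^sup>2 = e + n - v\<close> trades the squared bias for
    the mean e, at the price of another term of order \<open>n\<^sup>2\<close>.\<close>
  also have "\<dots> \<le> 8 * n\<^sup>2 + 8 * (e + n) * n"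
  proof -
    have "0 \<le> v" by (simp add: v_def)
    then have "P\<^sup>2 \<le> e + n" using e by simp
    then show ?thesis by (auto intro!: mult_right_mono simp: n_def)
  qed
  also have "\<dots> = 16 * n\<^sup>2 + 8 * n * e" by (simp add: power2_eq_square algebra_simps)
  finally show "expectation (\<lambda>\<omega>. (W \<omega> - e)\<^sup>2) \<le> 16 * (real (card K))\<^sup>2 + 8 * real (card K) * e"
    by (simp add: n_def)
qed

end

context prob_space
begin

text \<open>The l positions use disjoint sets of signs, so their statistics are independent and the
  variances add. As each bound is linear in its own mean, the sum depends only on the total mean E,
  however the signal is spread over the positions.\<close>

lemma total_collision_statistic_variance:
  fixes Y :: "nat \<times> nat \<Rightarrow> 'a \<Rightarrow> real" and n l :: nat
  assumes ind: "indep_vars (\<lambda>_. borel) Y ({..<n} \<times> {..<l})"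
    and pm: "\<And>k g \<omega>. k < n \<Longrightarrow> g < l \<Longrightarrow> \<omega> \<in> space M \<Longrightarrow> (Y (k, g) \<omega>)\<^sup>2 = 1"
    and mean: "\<And>k g. k < n \<Longrightarrow> g < l \<Longrightarrow> expectation (Y (k, g)) = p k g"
  defines "W \<equiv> \<lambda>\<omega>. \<Sum>g<l. (\<Sum>k<n. Y (k, g) \<omega>)\<^sup>2 - real n"
    and "E \<equiv> \<Sum>g<l. (\<Sum>k<n. p k g)\<^sup>2 - (\<Sum>k<n. (p k g)\<^sup>2)"
  shows "W \<in> borel_measurable M"
    and "integrable M (\<lambda>\<omega>. (W \<omega> - E)\<^sup>2)"
    and "expectation (\<lambda>\<omega>. (W \<omega> - E)\<^sup>2) \<le> 16 * real l * (real n)\<^sup>2 + 8 * real n * E"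
proof -
  define V where "V g \<omega> = (\<Sum>k<n. Y (k, g) \<omega>)\<^sup>2 - real n" for g \<omega>
  define e where "e g = (\<Sum>k<n. p k g)\<^sup>2 - (\<Sum>k<n. (p k g)\<^sup>2)" for g
  define \<xi> where "\<xi> g \<omega> = V g \<omega> - e g" for g \<omega>
  have indg: "indep_vars (\<lambda>_. borel) (\<lambda>k. Y (k, g)) {..<n}" if g: "g < l" for g
  proof -
    have "indep_vars (\<lambda>k. PiM {(k, g)} (\<lambda>_. borel)) (\<lambda>k \<omega>. restrict (\<lambda>i. Y i \<omega>) {(k, g)}) {..<n}"
      by (rule indep_vars_restrict[OF ind]) (use g in \<open>auto simp: disjoint_family_on_def\<close>)
    then have "indep_vars (\<lambda>_. borel) (\<lambda>k \<omega>. (\<lambda>f. f (k, g)) (restrict (\<lambda>i. Y i \<omega>) {(k, g)})) {..<n}"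
      by (rule indep_vars_compose2) measurable
    then show ?thesis by simp
  qed
  have EV: "expectation (V g) = e g" if "g < l" for g
    using collision_statistic_moments(1)[OF finite_lessThan indg[OF that], of "\<lambda>k. p k g"] pm mean that
    by (simp add: V_def[abs_def] e_def)
  have VV: "expectation (\<lambda>\<omega>. (\<xi> g \<omega>)\<^sup>2) \<le> 16 * (real n)\<^sup>2 + 8 * real n * e g" if "g < l" for g
    using collision_statistic_moments(2)[OF finite_lessThan indg[OF that], of "\<lambda>k. p k g"] pm mean that
    by (simp add: V_def e_def \<xi>_def)
  have Vm: "V g \<in> borel_measurable M" if "g < l" for g
    using collision_statistic_moments(4)[OF finite_lessThan indg[OF that], of "\<lambda>k. p k g"] pm mean that
    by (simp add: V_def[abs_def])
  have Vb: "\<bar>V g \<omega>\<bar> \<le> 2 * (real n)\<^sup>2" if "g < l" "\<omega> \<in> space M" for g \<omega>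
    using collision_statistic_moments(5)[OF finite_lessThan indg[OF that(1)], of "\<lambda>k. p k g"] pm mean that
    by (simp add: V_def)
  have eb: "\<bar>e g\<bar> \<le> 2 * (real n)\<^sup>2" if "g < l" for g
  proof -
    have "\<bar>e g\<bar> \<le> expectation (\<lambda>\<omega>. \<bar>V g \<omega>\<bar>)" unfolding EV[OF that, symmetric] by (rule integral_abs_bound)
    also have "\<dots> \<le> expectation (\<lambda>\<omega>. 2 * (real n)\<^sup>2)"
      using Vm[OF that] Vb[OF that]
      by (intro integral_mono integrable_bounded_rv[where B="2 * (real n)\<^sup>2"]) auto
    finally show ?thesis by (simp add: prob_space)
  qed
  have Vi: "integrable M (V g)" if "g < l" for g
    using Vm[OF that] Vb[OF that] by (rule integrable_bounded_rv)
  have \<xi>b: "\<bar>\<xi> g \<omega>\<bar> \<le> 4 * (real n)\<^sup>2" if "g < l" "\<omega> \<in> space M" for g \<omega>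
    using Vb[OF that] eb[OF that(1)] unfolding \<xi>_def by linarith
  have \<xi>ind: "indep_vars (\<lambda>_. borel) \<xi> {..<l}"
  proof -
    let ?K = "\<lambda>g. {..<n} \<times> {g}"
    have "indep_vars (\<lambda>g. PiM (?K g) (\<lambda>_. borel)) (\<lambda>g \<omega>. restrict (\<lambda>i. Y i \<omega>) (?K g)) {..<l}"
      by (rule indep_vars_restrict[OF ind]) (auto simp: disjoint_family_on_def)
    then have "indep_vars (\<lambda>_. borel) (\<lambda>g \<omega>. (\<lambda>f. (\<Sum>k<n. f (k, g))\<^sup>2 - real n - e g)
       (restrict (\<lambda>i. Y i \<omega>) (?K g))) {..<l}"
    proof (rule indep_vars_compose2)
      fix g :: nat
      have "(\<lambda>f. f (k, g)) \<in> borel_measurable (PiM (?K g) (\<lambda>_. borel))" if "k < n" for k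
        by (rule measurable_component_singleton) (use that in auto)
      then show "(\<lambda>f. (\<Sum>k<n. f (k, g))\<^sup>2 - real n - e g) \<in> borel_measurable (PiM (?K g) (\<lambda>_. borel))"
        by (intro borel_measurable_diff borel_measurable_power borel_measurable_sum) auto
    qed
    then show ?thesis by (rule indep_vars_cong[THEN iffD1, rotated -1]) (auto simp: \<xi>_def V_def fun_eq_iff)
  qed
  have W: "W \<omega> - E = (\<Sum>g<l. \<xi> g \<omega>)" for \<omega>
    by (simp add: W_def E_def \<xi>_def V_def e_def sum_subtractf)
  show Wm: "W \<in> borel_measurable M"
  proof -
    have "W = (\<lambda>\<omega>. \<Sum>g<l. V g \<omega>)" by (simp add: W_def V_def fun_eq_iff)
    then show ?thesis using Vm by simp
  qed
  show "integrable M (\<lambda>\<omega>. (W \<omega> - E)\<^sup>2)"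
  proof (rule integrable_bounded_rv[where B="(real l * (4 * (real n)\<^sup>2))\<^sup>2"])
    fix \<omega> assume \<omega>: "\<omega> \<in> space M"
    have "\<bar>W \<omega> - E\<bar> \<le> (\<Sum>g<l. \<bar>\<xi> g \<omega>\<bar>)" unfolding W by (rule sum_abs)
    also have "\<dots> \<le> real l * (4 * (real n)\<^sup>2)"
      using sum_bounded_above[of "{..<l}" "\<lambda>g. \<bar>\<xi> g \<omega>\<bar>" "4 * (real n)\<^sup>2"] \<xi>b \<omega> by simp
    finally have "(W \<omega> - E)\<^sup>2 \<le> (real l * (4 * (real n)\<^sup>2))\<^sup>2"
      by (intro abs_le_square_iff[THEN iffD1]) simp
    then show "\<bar>(W \<omega> - E)\<^sup>2\<bar> \<le> (real l * (4 * (real n)\<^sup>2))\<^sup>2" by simp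
  qed (use Wm in measurable)
  have "expectation (\<lambda>\<omega>. (W \<omega> - E)\<^sup>2) = (\<Sum>g<l. expectation (\<lambda>\<omega>. (\<xi> g \<omega>)\<^sup>2))"
    unfolding W using \<xi>b EV Vi
    by (intro second_moment_sum_indep_centred \<xi>ind) (auto simp: \<xi>_def[abs_def] prob_space)
  also have "\<dots> \<le> (\<Sum>g<l. 16 * (real n)\<^sup>2 + 8 * real n * e g)" by (intro sum_mono VV) auto
  also have "\<dots> = 16 * real l * (real n)\<^sup>2 + 8 * real n * E"
    by (simp add: E_def e_def sum.distrib sum_distrib_left)
  finally show "expectation (\<lambda>\<omega>. (W \<omega> - E)\<^sup>2) \<le> 16 * real l * (real n)\<^sup>2 + 8 * real n * E" .
qed

text \<open>Chebyshev's inequality in units of \<open>x = n * sqrt l\<close>. At mean 0 the variance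
  is at most \<open>16 * x\<^sup>2\<close>, so the level \<open>20 * x\<close> gives 16/400. For
  \<open>E \<ge> 1000 * x\<close> the level is below \<open>E / 2\<close>, and both variance terms
  are small multiples of \<open>E\<^sup>2\<close> since
  \<open>n \<le> x \<le> E / 1000\<close>.\<close>

lemma total_collision_statistic_tests:
  fixes Y :: "nat \<times> nat \<Rightarrow> 'a \<Rightarrow> real" and n l :: nat
  assumes n: "n \<ge> 1" and l: "l \<ge> 1"
    and ind: "indep_vars (\<lambda>_. borel) Y ({..<n} \<times> {..<l})"
    and pm: "\<And>k g \<omega>. k < n \<Longrightarrow> g < l \<Longrightarrow> \<omega> \<in> space M \<Longrightarrow> (Y (k, g) \<omega>)\<^sup>2 = 1"
    and mean: "\<And>k g. k < n \<Longrightarrow> g < l \<Longrightarrow> expectation (Y (k, g)) = p k g"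
  defines "W \<equiv> \<lambda>\<omega>. \<Sum>g<l. (\<Sum>k<n. Y (k, g) \<omega>)\<^sup>2 - real n"
    and "E \<equiv> \<Sum>g<l. (\<Sum>k<n. p k g)\<^sup>2 - (\<Sum>k<n. (p k g)\<^sup>2)"
    and "t \<equiv> 20 * real n * sqrt (real l)"
  shows "E = 0 \<Longrightarrow> prob {\<omega> \<in> space M. W \<omega> \<ge> t} \<le> 1 / 20"
    and "E \<ge> 1000 * real n * sqrt (real l) \<Longrightarrow> prob {\<omega> \<in> space M. W \<omega> < t} \<le> 1 / 20"
proof -
  define x where "x = real n * sqrt (real l)"
  have n0: "real n > 0" and l1: "sqrt (real l) \<ge> 1" using n l by auto
  have x0: "x > 0" using n0 l1 by (simp add: x_def)
  have nx: "real n \<le> x" using mult_left_mono[OF l1, of "real n"] by (simp add: x_def)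
  have x2: "real l * (real n)\<^sup>2 = x\<^sup>2" by (simp add: x_def power_mult_distrib)
  have V: "W \<in> borel_measurable M" "integrable M (\<lambda>\<omega>. (W \<omega> - E)\<^sup>2)"
    "expectation (\<lambda>\<omega>. (W \<omega> - E)\<^sup>2) \<le> 16 * real l * (real n)\<^sup>2 + 8 * real n * E"
    unfolding W_def E_def by (rule total_collision_statistic_variance[OF ind pm mean]; assumption)+
  have [measurable]: "W \<in> borel_measurable M" by (rule V(1))
  have var: "expectation (\<lambda>\<omega>. (W \<omega> - E)\<^sup>2) \<le> 16 * x\<^sup>2 + 8 * real n * E"
    using V(3) by (simp add: mult.assoc x2)
  have dev: "prob {\<omega> \<in> space M. a \<le> \<bar>W \<omega> - E\<bar>} \<le> (16 * x\<^sup>2 + 8 * real n * E) / a\<^sup>2" if "a > 0" for a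
  proof -
    have "prob {\<omega> \<in> space M. a \<le> \<bar>W \<omega> - E\<bar>} \<le> expectation (\<lambda>\<omega>. (W \<omega> - E)\<^sup>2) / a\<^sup>2"
      by (rule second_moment_method) (use V that in auto)
    also have "\<dots> \<le> (16 * x\<^sup>2 + 8 * real n * E) / a\<^sup>2" using var by (intro divide_right_mono) auto
    finally show ?thesis .
  qed
  have t: "t = 20 * x" by (simp add: t_def x_def)
  show "prob {\<omega> \<in> space M. W \<omega> \<ge> t} \<le> 1 / 20" if E: "E = 0"
  proof -
    have "prob {\<omega> \<in> space M. W \<omega> \<ge> t} \<le> prob {\<omega> \<in> space M. t \<le> \<bar>W \<omega> - E\<bar>}"
      using E by (intro finite_measure_mono) auto
    also have "\<dots> \<le> 16 * x\<^sup>2 / (20 * x)\<^sup>2" using dev[of t] x0 E t by simp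
    also have "\<dots> \<le> 1 / 20" using x0 by (simp add: power_mult_distrib)
    finally show ?thesis .
  qed
  show "prob {\<omega> \<in> space M. W \<omega> < t} \<le> 1 / 20" if "E \<ge> 1000 * real n * sqrt (real l)"
  proof -
    have E: "E \<ge> 1000 * x" using that by (simp add: x_def mult.assoc)
    then have E0: "E > 0" using x0 by linarith
    have "prob {\<omega> \<in> space M. W \<omega> < t} \<le> prob {\<omega> \<in> space M. E / 2 \<le> \<bar>W \<omega> - E\<bar>}"
      using E t x0 by (intro finite_measure_mono) auto
    also have "\<dots> \<le> (16 * x\<^sup>2 + 8 * real n * E) / (E / 2)\<^sup>2" using dev[of "E / 2"] E0 by simp
    also have "\<dots> \<le> 1 / 20"
    proof -
      have xE: "x \<le> E / 1000" using E by simp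
      then have "x\<^sup>2 \<le> (E / 1000)\<^sup>2" using x0 by (intro power_mono) auto
      then have "x\<^sup>2 \<le> E\<^sup>2 / 1000000" by (simp add: power_divide)
      moreover have "real n * E \<le> E / 1000 * E" using nx xE E0 by (intro mult_right_mono) auto
      then have "real n * E \<le> E\<^sup>2 / 1000" by (simp add: power2_eq_square)
      moreover have "0 \<le> E\<^sup>2" by simp
      ultimately have "16 * x\<^sup>2 + 8 * (real n * E) \<le> E\<^sup>2 / 80" by linarith
      then have "16 * x\<^sup>2 + 8 * real n * E \<le> 1 / 20 * (E / 2)\<^sup>2" by (simp add: power_divide mult.assoc)
      then show ?thesis using E0 by (simp add: pos_divide_le_eq)
    qed
    finally show ?thesis .
  qed
qed

end

subsection \<open>Signs of Gaussian projections\<close>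

lemma indep_vars_measure_preserving:
  assumes M: "prob_space M" and N: "prob_space N" and f: "f \<in> measurable M N" "distr M N f = N"
    and I: "finite I" "I \<noteq> {}" and ind: "prob_space.indep_vars N M' X I"
  shows "prob_space.indep_vars M M' (\<lambda>i \<omega>. X i (f \<omega>)) I"
proof -
  interpret M: prob_space M by fact
  interpret N: prob_space N by fact
  have rv: "X i \<in> measurable N (M' i)" if "i \<in> I" for i using ind that by (simp add: N.indep_vars_def)
  have pre: "M.prob (f -` A \<inter> space M) = N.prob A" if "A \<in> sets N" for A
    using f that by (metis measure_distr)
  show ?thesis
  proof (subst M.indep_vars_finite[where E="\<lambda>i. sets (M' i)"])
    show "\<forall>A\<in>\<Pi> i\<in>I. sets (M' i). M.prob (\<Inter>j\<in>I. (\<lambda>\<omega>. X j (f \<omega>)) -` A j \<inter> space M) =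
        (\<Prod>j\<in>I. M.prob ((\<lambda>\<omega>. X j (f \<omega>)) -` A j \<inter> space M))"
    proof
      fix A assume A: "A \<in> (\<Pi> i\<in>I. sets (M' i))"
      have s: "(\<lambda>\<omega>. X j (f \<omega>)) -` A j \<inter> space M = f -` (X j -` A j \<inter> space N) \<inter> space M" for j
        using measurable_space[OF f(1)] by auto
      have sN: "X j -` A j \<inter> space N \<in> sets N" if "j \<in> I" for j
        using that A rv by (auto intro: measurable_sets)
      have "(\<Inter>j\<in>I. (\<lambda>\<omega>. X j (f \<omega>)) -` A j \<inter> space M) = f -` (\<Inter>j\<in>I. X j -` A j \<inter> space N) \<inter> space M"
        unfolding s using I(2) by auto
      moreover have "(\<Inter>j\<in>I. X j -` A j \<inter> space N) \<in> sets N" by (intro sets.finite_INT I sN)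
      ultimately have "M.prob (\<Inter>j\<in>I. (\<lambda>\<omega>. X j (f \<omega>)) -` A j \<inter> space M) = N.prob (\<Inter>j\<in>I. X j -` A j \<inter> space N)"
        by (simp only: pre)
      also have "\<dots> = (\<Prod>j\<in>I. N.prob (X j -` A j \<inter> space N))"
        using A I by (intro N.indep_varsD[OF ind]) auto
      also have "\<dots> = (\<Prod>j\<in>I. M.prob ((\<lambda>\<omega>. X j (f \<omega>)) -` A j \<inter> space M))"
        unfolding s by (intro prod.cong refl pre[symmetric] sN)
      finally show "M.prob (\<Inter>j\<in>I. (\<lambda>\<omega>. X j (f \<omega>)) -` A j \<inter> space M) =
        (\<Prod>j\<in>I. M.prob ((\<lambda>\<omega>. X j (f \<omega>)) -` A j \<inter> space M))" .
    qed
  qed (use I f rv in \<open>auto simp: sets.sigma_sets_eq sets.Int_stable sets.space_closed[THEN subsetD] intro: measurable_compose dest: sets.sets_into_space\<close>)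
qed

text \<open>An intersection of events, one for each index pair, is a rectangle of the product: it
  factors over k by the product measure and then over i by independence inside each factor. It is
  applied twice, to the samples of a user and to the users.\<close>

lemma indep_vars_PiM_nested:
  fixes N :: "'k \<Rightarrow> 'a measure" and X :: "'k \<Rightarrow> 'i \<Rightarrow> 'a \<Rightarrow> 'b"
  assumes N: "\<And>k. prob_space (N k)" and K: "finite K" "K \<noteq> {}" and I: "\<And>k. k \<in> K \<Longrightarrow> finite (I k)" "\<And>k. k \<in> K \<Longrightarrow> I k \<noteq> {}"
    and ind: "\<And>k. k \<in> K \<Longrightarrow> prob_space.indep_vars (N k) (\<lambda>_. L) (X k) (I k)"
  shows "prob_space.indep_vars (PiM K N) (\<lambda>_. L) (\<lambda>p \<omega>. X (fst p) (snd p) (\<omega> (fst p))) (Sigma K I)"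
proof -
  interpret N: prob_space "N k" for k by (rule N)
  interpret P: finite_product_prob_space N K by unfold_locales (rule K)
  have rv: "X k i \<in> measurable (N k) L" if "k \<in> K" "i \<in> I k" for k i
    using ind[OF that(1)] that by (simp add: N.indep_vars_def)
  have rvP: "(\<lambda>\<omega>. X k i (\<omega> k)) \<in> measurable (PiM K N) L" if "k \<in> K" "i \<in> I k" for k i
    using measurable_compose[where f="\<lambda>\<omega>. \<omega> k" and g="X k i" and M="PiM K N" and N="N k" and L=L]
      measurable_component_singleton[OF that(1), of N] rv[OF that] by blast
  have ne: "Sigma K I \<noteq> {}" using K I by auto
  show ?thesis
  proof (subst P.indep_vars_finite[where E="\<lambda>_. sets L"])
    show "\<forall>A\<in>Sigma K I \<rightarrow> sets L.
       P.prob (\<Inter>p\<in>Sigma K I. (\<lambda>\<omega>. X (fst p) (snd p) (\<omega> (fst p))) -` A p \<inter> space (PiM K N)) =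
       (\<Prod>p\<in>Sigma K I. P.prob ((\<lambda>\<omega>. X (fst p) (snd p) (\<omega> (fst p))) -` A p \<inter> space (PiM K N)))"
    proof
      fix A assume A: "A \<in> Sigma K I \<rightarrow> sets L"
      define B where "B k i = X k i -` A (k, i) \<inter> space (N k)" for k i
      have B: "B k i \<in> sets (N k)" if "k \<in> K" "i \<in> I k" for k i
        unfolding B_def using that A rv by (auto intro!: measurable_sets)
      have BI: "(\<Inter>i\<in>I k. B k i) \<in> sets (N k)" if "k \<in> K" for k
        using B that I by (intro sets.finite_INT) auto
      have "(\<Inter>p\<in>Sigma K I. (\<lambda>\<omega>. X (fst p) (snd p) (\<omega> (fst p))) -` A p \<inter> space (PiM K N)) = PiE K (\<lambda>k. \<Inter>i\<in>I k. B k i)"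
        (is "?L = ?R")
      proof (rule set_eqI)
        fix \<omega>
        from ne have "\<omega> \<in> ?L \<longleftrightarrow> \<omega> \<in> PiE K (\<lambda>k. space (N k)) \<and> (\<forall>k\<in>K. \<forall>i\<in>I k. X k i (\<omega> k) \<in> A (k, i))"
          by (auto simp: space_PiM)
        also have "\<dots> \<longleftrightarrow> \<omega> \<in> ?R"
          using I(2) by (auto simp: B_def PiE_iff)
        finally show "\<omega> \<in> ?L \<longleftrightarrow> \<omega> \<in> ?R" .
      qed
      then have "P.prob (\<Inter>p\<in>Sigma K I. (\<lambda>\<omega>. X (fst p) (snd p) (\<omega> (fst p))) -` A p \<inter> space (PiM K N))
          = (\<Prod>k\<in>K. N.prob k (\<Inter>i\<in>I k. B k i))"
        using P.prob_times[OF BI] by simp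
      also have "\<dots> = (\<Prod>k\<in>K. \<Prod>i\<in>I k. N.prob k (B k i))"
        unfolding B_def using A I by (intro prod.cong refl N.indep_varsD[OF ind]) auto
      also have "\<dots> = (\<Prod>p\<in>Sigma K I. N.prob (fst p) (B (fst p) (snd p)))"
        using K I by (subst prod.Sigma) (auto simp: case_prod_unfold)
      also have "\<dots> = (\<Prod>p\<in>Sigma K I. P.prob ((\<lambda>\<omega>. X (fst p) (snd p) (\<omega> (fst p))) -` A p \<inter> space (PiM K N)))"
      proof (intro prod.cong refl)
        fix p assume "p \<in> Sigma K I"
        then obtain k i where p: "p = (k, i)" "k \<in> K" "i \<in> I k" by auto
        have "N.prob k (B k i) = measure (distr (PiM K N) (N k) (\<lambda>\<omega>. \<omega> k)) (B k i)"
          using P.PiM_component[OF p(2)] by simp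
        also have "\<dots> = P.prob ((\<lambda>\<omega>. \<omega> k) -` B k i \<inter> space (PiM K N))"
          using p B by (intro measure_distr) auto
        also have "(\<lambda>\<omega>. \<omega> k) -` B k i \<inter> space (PiM K N) = (\<lambda>\<omega>. X k i (\<omega> k)) -` A p \<inter> space (PiM K N)"
          using p by (auto simp: B_def space_PiM PiE_iff)
        finally show "N.prob (fst p) (B (fst p) (snd p)) =
          P.prob ((\<lambda>\<omega>. X (fst p) (snd p) (\<omega> (fst p))) -` A p \<inter> space (PiM K N))" using p by simp
      qed
      finally show "P.prob (\<Inter>p\<in>Sigma K I. (\<lambda>\<omega>. X (fst p) (snd p) (\<omega> (fst p))) -` A p \<inter> space (PiM K N)) =
       (\<Prod>p\<in>Sigma K I. P.prob ((\<lambda>\<omega>. X (fst p) (snd p) (\<omega> (fst p))) -` A p \<inter> space (PiM K N)))" .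
    qed
  qed (use K I ne rvP in \<open>auto simp: sets.sigma_sets_eq sets.Int_stable dest: sets.sets_into_space\<close>)
qed

lemma indep_vars_gaussian:
  assumes "d \<ge> 1"
  shows "prob_space.indep_vars (gaussian d \<mu>) (\<lambda>_. borel) (\<lambda>i x. x i) {..<d}"
proof -
  define N where "N i = density lborel (\<lambda>x. ennreal (normal_density (\<mu> i) 1 x))" for i
  interpret N: prob_space "N a" for a unfolding N_def by (rule prob_space_normal_density) simp
  interpret P: finite_product_prob_space N "{..<d}" by unfold_locales simp
  have G: "gaussian d \<mu> = PiM {..<d} N" by (simp add: gaussian_eq_PiM N_def[abs_def])
  have sets_N: "sets (N i) = sets borel" for i by (simp add: N_def)
  have "distr (PiM {..<d} N) (PiM {..<d} (\<lambda>_. borel)) (\<lambda>x. \<lambda>i\<in>{..<d}. x i) = distr (PiM {..<d} N) (PiM {..<d} N) (\<lambda>x. x)"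
    by (intro distr_cong sets_PiM_cong) (auto simp: sets_N space_PiM PiE_restrict)
  also have "\<dots> = PiM {..<d} N" by simp
  also have "\<dots> = PiM {..<d} (\<lambda>i. distr (PiM {..<d} N) borel (\<lambda>x. x i))"
  proof (intro PiM_cong refl)
    fix i assume "i \<in> {..<d}"
    then have "N i = distr (PiM {..<d} N) (N i) (\<lambda>x. x i)" by (simp add: P.PiM_component)
    also have "\<dots> = distr (PiM {..<d} N) borel (\<lambda>x. x i)" by (intro distr_cong) (auto simp: sets_N)
    finally show "N i = distr (PiM {..<d} N) borel (\<lambda>x. x i)" .
  qed
  finally have eq: "distr (PiM {..<d} N) (PiM {..<d} (\<lambda>_. borel)) (\<lambda>x. \<lambda>i\<in>{..<d}. x i)
      = PiM {..<d} (\<lambda>i. distr (PiM {..<d} N) borel (\<lambda>x. x i))" .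
  have rv: "(\<lambda>x. x i) \<in> borel_measurable (PiM {..<d} N)" if "i \<in> {..<d}" for i
    using measurable_component_singleton[OF that, of N] by (simp cong: measurable_cong_sets add: sets_N)
  have "0 \<in> {..<d}" using assms by simp
  then have "{..<d} \<noteq> {}" by blast
  then show ?thesis unfolding G
    by (subst P.indep_vars_iff_distr_eq_PiM'[OF _ rv]) (auto simp: eq)
qed

lemma distr_gaussian_component:
  assumes "i < d"
  shows "distr (gaussian d \<mu>) borel (\<lambda>x. x i) = density lborel (\<lambda>x. ennreal (normal_density (\<mu> i) 1 x))"
proof -
  define N where "N a = density lborel (\<lambda>x. ennreal (normal_density (\<mu> a) 1 x))" for a
  interpret N: prob_space "N a" for a unfolding N_def by (rule prob_space_normal_density) simp
  interpret P: finite_product_prob_space N "{..<d}" by unfold_locales simp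
  have G: "gaussian d \<mu> = PiM {..<d} N" by (simp add: gaussian_eq_PiM N_def[abs_def])
  have "distr (PiM {..<d} N) borel (\<lambda>x. x i) = distr (PiM {..<d} N) (N i) (\<lambda>x. x i)"
    by (intro distr_cong) (auto simp: N_def)
  also have "\<dots> = N i" using assms by (intro P.PiM_component) simp
  finally show ?thesis by (simp add: G N_def)
qed

section \<open>Normal projections and the bias of their sign\<close>

lemma (in prob_space) distributed_weighted_sum_normal:
  fixes X :: "'i \<Rightarrow> 'a \<Rightarrow> real"
  assumes I: "finite I" and ind: "indep_vars (\<lambda>_. borel) X I"
    and X: "\<And>i. i \<in> I \<Longrightarrow> distributed M lborel (X i) (normal_density (\<mu> i) 1)"
    and c: "\<exists>i\<in>I. c i \<noteq> 0"
  shows "distributed M lborel (\<lambda>\<omega>. \<Sum>i\<in>I. c i * X i \<omega>)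
    (normal_density (\<Sum>i\<in>I. c i * \<mu> i) (sqrt (\<Sum>i\<in>I. (c i)\<^sup>2)))"
proof -
  \<comment> \<open>A zero weight would contribute a degenerate normal law of deviation 0, so such
    terms are dropped; the nonzero weight keeps the remaining sum nonempty.\<close>
  define J where "J = {i\<in>I. c i \<noteq> 0}"
  have J: "finite J" "J \<noteq> {}" "J \<subseteq> I" using I c by (auto simp: J_def)
  have s: "(\<Sum>i\<in>J. c i * f i) = (\<Sum>i\<in>I. c i * f i)" for f :: "'i \<Rightarrow> real"
    using I by (intro sum.mono_neutral_left) (auto simp: J_def)
  have "indep_vars (\<lambda>_. borel) (\<lambda>i \<omega>. c i * X i \<omega>) J"
    by (rule indep_vars_compose2[OF indep_vars_subset[OF ind J(3)]]) auto
  moreover have "distributed M lborel (\<lambda>\<omega>. c i * X i \<omega>) (normal_density (c i * \<mu> i) \<bar>c i\<bar>)" if "i \<in> J" for i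
    using normal_density_affine[OF X[of i], of "c i" 0] that by (auto simp: J_def)
  ultimately have "distributed M lborel (\<lambda>\<omega>. \<Sum>i\<in>J. c i * X i \<omega>)
      (normal_density (\<Sum>i\<in>J. c i * \<mu> i) (sqrt (\<Sum>i\<in>J. \<bar>c i\<bar>\<^sup>2)))"
    by (intro sum_indep_normal J) (auto simp: J_def)
  then show ?thesis using s[of c] by (simp add: s power2_eq_square)
qed

text \<open>Ties go to 1, as in the transmitted bit; unlike \<open>sgn\<close> it never takes the
  value 0, so its square is always 1.\<close>

definition sgn1 :: "real \<Rightarrow> real" where "sgn1 x = (if x \<ge> 0 then 1 else - 1)"

lemma sgn1_measurable [measurable]: "sgn1 \<in> borel_measurable borel"
  unfolding sgn1_def[abs_def] by measurable

text \<open>For a standard normal Z this is \<open>P(Z \<ge> - t) - P(Z < - t)\<close>, that is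
  \<open>2 * \<Phi>(t) - 1\<close>.\<close>

definition sign_bias :: "real \<Rightarrow> real" where
  "sign_bias t = (\<integral>x. std_normal_density x * sgn1 (x + t) \<partial>lborel)"

lemma (in prob_space) expectation_sgn1_normal:
  assumes X: "distributed M lborel X (normal_density \<mu> \<sigma>)" and \<sigma>: "\<sigma> > 0"
  shows "expectation (\<lambda>\<omega>. sgn1 (X \<omega>)) = sign_bias (\<mu> / \<sigma>)"
proof -
  have Z: "distributed M lborel (\<lambda>\<omega>. (X \<omega> - \<mu>) / \<sigma>) std_normal_density"
    using X normal_standard_normal_convert[OF \<sigma>] by blast
  have "expectation (\<lambda>\<omega>. sgn1 (X \<omega>)) = expectation (\<lambda>\<omega>. sgn1 ((X \<omega> - \<mu>) / \<sigma> + \<mu> / \<sigma>))"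
  proof (intro Bochner_Integration.integral_cong refl)
    fix \<omega>
    have "(X \<omega> - \<mu>) / \<sigma> + \<mu> / \<sigma> = X \<omega> / \<sigma>" by (simp add: diff_divide_distrib)
    then show "sgn1 (X \<omega>) = sgn1 ((X \<omega> - \<mu>) / \<sigma> + \<mu> / \<sigma>)" using \<sigma> by (simp add: sgn1_def zero_le_divide_iff)
  qed
  also have "\<dots> = sign_bias (\<mu> / \<sigma>)" unfolding sign_bias_def
    by (rule distributed_integral[OF Z, symmetric]) auto
  finally show ?thesis .
qed

lemma std_normal_density_ge:
  assumes "\<bar>x\<bar> \<le> 1" shows "std_normal_density x \<ge> 1 / 6"
proof -
  \<comment> \<open>The constant 1/6 combines \<open>exp (- 1/2) \<ge> 1/2\<close> with
    \<open>sqrt (2 * pi) \<le> 3\<close>.\<close>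
  have "sqrt (2 * pi) \<le> sqrt (3\<^sup>2)" using pi_less_4 by (intro real_sqrt_le_mono) simp
  then have s: "sqrt (2 * pi) \<le> 3" "sqrt (2 * pi) > 0" by auto
  have "x\<^sup>2 \<le> 1" using assms by (simp add: abs_square_le_1)
  then have "1 / 2 \<le> 1 + (- x\<^sup>2 / 2)" by simp
  also have "\<dots> \<le> exp (- x\<^sup>2 / 2)" by (rule exp_ge_add_one_self)
  finally have "(1 / 2) / 3 \<le> exp (- x\<^sup>2 / 2) / sqrt (2 * pi)" using s by (intro frac_le) auto
  then show ?thesis by (simp add: std_normal_density_def)
qed

lemma integrable_std_normal_bounded:
  assumes [measurable]: "f \<in> borel_measurable borel" and "\<And>x. \<bar>f x\<bar> \<le> 2"
  shows "integrable lborel (\<lambda>x. std_normal_density x * f x)"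
proof (rule Bochner_Integration.integrable_bound[of _ "\<lambda>x. 2 * std_normal_density x"])
  show "AE x in lborel. norm (std_normal_density x * f x) \<le> norm (2 * std_normal_density x)"
    using mult_left_mono[OF assms(2), of "std_normal_density _"] by (simp add: abs_mult mult.commute)
qed auto

text \<open>Averaging over the reflection \<open>x \<mapsto> -x\<close> leaves only the mass of \<open>(-\<bar>t\<bar>, \<bar>t\<bar>)\<close>.\<close>
lemma sign_bias_symmetrized:
  "2 * sign_bias t = (\<integral>x. std_normal_density x * (sgn1 (x + t) + sgn1 (t - x)) \<partial>lborel)"
proof -
  have "sign_bias t = (\<integral>x. std_normal_density (- x) * sgn1 (- x + t) \<partial>lborel)"
    unfolding sign_bias_def using lborel_integral_real_affine[of "-1" "\<lambda>x. std_normal_density x * sgn1 (x + t)" 0] by simp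
  also have "\<dots> = (\<integral>x. std_normal_density x * sgn1 (t - x) \<partial>lborel)"
    by (simp add: std_normal_density_def)
  finally have "2 * sign_bias t = (\<integral>x. std_normal_density x * sgn1 (x + t) \<partial>lborel)
      + (\<integral>x. std_normal_density x * sgn1 (t - x) \<partial>lborel)" by (simp add: sign_bias_def)
  also have "\<dots> = (\<integral>x. std_normal_density x * sgn1 (x + t) + std_normal_density x * sgn1 (t - x) \<partial>lborel)"
    by (intro Bochner_Integration.integral_add[symmetric] integrable_std_normal_bounded)
      (auto simp: sgn1_def)
  finally show ?thesis by (simp add: distrib_left)
qed

text \<open>Serves both signs of t, with f the symmetrized sign sum or its negative and s the
  minimum of \<open>\<bar>t\<bar>\<close> and 1. The interval of length \<open>2 * s\<close> stays
  where the density is at least 1/6, and f is 2 there.\<close>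

lemma integral_std_normal_ge:
  assumes s: "0 \<le> s" "s \<le> 1" and [measurable]: "f \<in> borel_measurable borel" and f: "\<And>x. 0 \<le> f x" "\<And>x. f x \<le> 2"
    and fs: "\<And>x. \<bar>x\<bar> < s \<Longrightarrow> f x = 2"
  shows "(\<integral>x. std_normal_density x * f x \<partial>lborel) \<ge> 2 * s / 3"
proof -
  have "2 * s / 3 = (\<integral>x. 1 / 3 * indicator {-s<..<s} x \<partial>lborel)" using s by simp
  also have "\<dots> \<le> (\<integral>x. std_normal_density x * f x \<partial>lborel)"
  proof (rule integral_mono)
    show "integrable lborel (\<lambda>x. 1 / 3 * indicator {-s<..<s} x :: real)" using s by (intro integrable_mult_right) simp
    show "integrable lborel (\<lambda>x. std_normal_density x * f x)"
      using f by (intro integrable_std_normal_bounded) auto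
    fix x
    show "1 / 3 * indicator {-s<..<s} x \<le> std_normal_density x * f x"
    proof (cases "x \<in> {-s<..<s}")
      case True
      then have "\<bar>x\<bar> < s" by auto
      then have "f x = 2" "std_normal_density x \<ge> 1 / 6" using s fs std_normal_density_ge[of x] by auto
      then show ?thesis using True by simp
    qed (use f in simp)
  qed
  finally show ?thesis .
qed

text \<open>The symmetrized integrand vanishes off the tie \<open>x = 0\<close>, a null set.
  Fairness is thus exact, and the statistic has mean 0 under the null hypothesis.\<close>

lemma sign_bias_0: "sign_bias 0 = 0"
proof -
  have ae: "AE x in lborel. x \<noteq> (0 :: real)" by (rule AE_lborel_singleton)
  have "(\<integral>x. std_normal_density x * (sgn1 (x + 0) + sgn1 (0 - x)) \<partial>lborel) = (\<integral>x. 0 \<partial>(lborel :: real measure))"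
  proof (rule integral_cong_AE)
    show "AE x in lborel. std_normal_density x * (sgn1 (x + 0) + sgn1 (0 - x)) = 0"
      using ae by eventually_elim (auto simp: sgn1_def)
  qed measurable
  then show ?thesis using sign_bias_symmetrized[of 0] by simp
qed

lemma sign_bias_pos:
  assumes t: "t \<ge> 0" shows "sign_bias t \<ge> min t 1 / 3"
proof -
  have "2 * min t 1 / 3 \<le> (\<integral>x. std_normal_density x * (sgn1 (x + t) + sgn1 (t - x)) \<partial>lborel)"
    using t by (intro integral_std_normal_ge) (auto simp: sgn1_def)
  then show ?thesis unfolding sign_bias_symmetrized[symmetric] by simp
qed

lemma sign_bias_neg:
  assumes t: "t \<le> 0" shows "- sign_bias t \<ge> min (- t) 1 / 3"
proof (cases "t = 0")
  \<comment> \<open>At \<open>t = 0\<close> the tie gives the negated sign sum the value -2 at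
    \<open>x = 0\<close>, so the bound for nonnegative f does not apply.\<close>
  case True then show ?thesis using sign_bias_0 by simp
next
  case False
  then have "2 * min (- t) 1 / 3 \<le> (\<integral>x. std_normal_density x * - (sgn1 (x + t) + sgn1 (t - x)) \<partial>lborel)"
    using t by (intro integral_std_normal_ge) (auto simp: sgn1_def)
  also have "\<dots> = - (2 * sign_bias t)"
    unfolding sign_bias_symmetrized mult_minus_right by (rule integral_minus)
  finally show ?thesis by simp
qed

section \<open>Joint law of the transmitted signs for a fixed seed\<close>

definition block :: "nat \<Rightarrow> nat \<Rightarrow> nat \<Rightarrow> nat set" where
  "block d l g = {i. i < d \<and> i mod l = g}"

lemma finite_block [simp]: "finite (block d l g)" by (simp add: block_def)

text \<open>In a residue class modulo l, coordinate i has position \<open>i div l\<close>; one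
  direction v is shared by all blocks, and for \<open>l \<le> d\<close> each block below l has the
  position 0. Adding up m samples improves the ratio of mean to deviation by
  \<open>sqrt m\<close>.\<close>

definition block_sum :: "(nat \<Rightarrow> real) \<Rightarrow> nat \<Rightarrow> nat \<Rightarrow> nat \<Rightarrow> (nat \<Rightarrow> nat \<Rightarrow> real) \<Rightarrow> nat \<Rightarrow> real" where
  "block_sum v d l m x g = (\<Sum>j<m. \<Sum>i\<in>block d l g. v (i div l) * x j i)"

lemma prob_space_real_return: "prob_space (return borel (0 :: real))"
  by (rule prob_space_return) simp

context
  fixes d n :: nat and m :: "nat \<Rightarrow> nat" and \<mu> :: "nat \<Rightarrow> real" and N Q
  assumes d: "d \<ge> 1" and n: "n \<ge> 1" and m: "\<And>k. k < n \<Longrightarrow> m k \<ge> 1"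
  defines "N \<equiv> \<lambda>k. return borel (0 :: real) \<Otimes>\<^sub>M PiM {..<m k} (\<lambda>_. gaussian d \<mu>)"
    and "Q \<equiv> PiM {..<n} N"
begin

lemma prob_space_user: "prob_space (N k)"
  unfolding N_def by (intro prob_space_pair prob_space_PiM prob_space_gaussian prob_space_real_return)

lemma prob_space_users: "prob_space Q"
  unfolding Q_def by (intro prob_space_PiM prob_space_user)

lemma distr_snd_user: "distr (N k) (PiM {..<m k} (\<lambda>_. gaussian d \<mu>)) snd = PiM {..<m k} (\<lambda>_. gaussian d \<mu>)"
proof -
  interpret G: prob_space "PiM {..<m k} (\<lambda>_. gaussian d \<mu>)" by (intro prob_space_PiM prob_space_gaussian)
  interpret R: prob_space "return borel (0 :: real)" by (rule prob_space_real_return)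
  interpret pair_prob_space "return borel (0 :: real)" "PiM {..<m k} (\<lambda>_. gaussian d \<mu>)" ..
  show ?thesis
  proof (rule measure_eqI)
    fix A assume "A \<in> sets (distr (N k) (PiM {..<m k} (\<lambda>_. gaussian d \<mu>)) snd)"
    then have A: "A \<in> sets (PiM {..<m k} (\<lambda>_. gaussian d \<mu>))" by simp
    have "snd -` A \<inter> space (N k) = space (return borel (0 :: real)) \<times> A"
      using sets.sets_into_space[OF A] by (auto simp: N_def space_pair_measure)
    then have "emeasure (distr (N k) (PiM {..<m k} (\<lambda>_. gaussian d \<mu>)) snd) A
        = emeasure (N k) (space (return borel (0 :: real)) \<times> A)"
      using A by (subst emeasure_distr) (auto simp: N_def)
    also have "\<dots> = emeasure (return borel (0 :: real)) (space (return borel (0 :: real))) * emeasure (PiM {..<m k} (\<lambda>_. gaussian d \<mu>)) A"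
      unfolding N_def using A by (intro G.emeasure_pair_measure_Times) auto
    finally show "emeasure (distr (N k) (PiM {..<m k} (\<lambda>_. gaussian d \<mu>)) snd) A = emeasure (PiM {..<m k} (\<lambda>_. gaussian d \<mu>)) A"
      by (simp add: R.emeasure_space_1)
  qed simp
qed

text \<open>Independence is assembled from the inside out: coordinates of a sample, samples of a
  user, then users. Between the last two, the measure-preserving projection \<open>snd\<close>
  handles the private component.\<close>

lemma indep_vars_sample_coordinates:
  "prob_space.indep_vars Q (\<lambda>_. borel) (\<lambda>p \<omega>. snd (\<omega> (fst p)) (fst (snd p)) (snd (snd p)))
    (Sigma {..<n} (\<lambda>k. {..<m k} \<times> {..<d}))"
proof -
  let ?G = "\<lambda>k. PiM {..<m k} (\<lambda>_. gaussian d \<mu>)"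
  have d0: "{..<d} \<noteq> {}" and n0: "{..<n} \<noteq> {}" using d n by (auto simp: lessThan_empty_iff)
  have m0: "{..<m k} \<noteq> {}" if "k < n" for k using m[OF that] by (auto simp: lessThan_empty_iff)
  have 1: "prob_space.indep_vars (?G k) (\<lambda>_. borel) (\<lambda>p x. x (fst p) (snd p)) ({..<m k} \<times> {..<d})" if "k < n" for k
    by (rule indep_vars_PiM_nested[where X="\<lambda>_ i x. x i"])
      (use m0[OF that] d0 in \<open>auto intro: prob_space_gaussian indep_vars_gaussian[OF d]\<close>)
  have 2: "prob_space.indep_vars (N k) (\<lambda>_. borel) (\<lambda>p x. snd x (fst p) (snd p)) ({..<m k} \<times> {..<d})" if "k < n" for k
    by (rule indep_vars_measure_preserving[OF prob_space_user _ _ distr_snd_user _ _ 1[OF that]])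
      (use m0[OF that] d0 in \<open>auto simp: N_def intro!: prob_space_PiM prob_space_gaussian\<close>)
  show ?thesis unfolding Q_def
    by (rule indep_vars_PiM_nested[where X="\<lambda>_ q x. snd x (fst q) (snd q)" and N=N, OF prob_space_user])
      (use m0 d0 n0 2 in auto)
qed

lemma distributed_sample_coordinate:
  assumes k: "k < n" and j: "j < m k" and i: "i < d"
  shows "distributed Q lborel (\<lambda>\<omega>. snd (\<omega> k) j i) (normal_density (\<mu> i) 1)"
proof -
  let ?G = "PiM {..<m k} (\<lambda>_. gaussian d \<mu>)"
  interpret N: prob_space "N a" for a by (rule prob_space_user)
  interpret P: finite_product_prob_space N "{..<n}" by unfold_locales simp
  interpret G: prob_space "gaussian d \<mu>" by (rule prob_space_gaussian)
  interpret PG: finite_product_prob_space "\<lambda>_. gaussian d \<mu>" "{..<m k}" by unfold_locales simp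
  have c1: "(\<lambda>\<omega>. \<omega> k) \<in> measurable Q (N k)" unfolding Q_def using k by simp
  have c2: "snd \<in> measurable (N k) ?G" by (simp add: N_def)
  have c3: "(\<lambda>x. x j) \<in> measurable ?G (gaussian d \<mu>)" using j by simp
  have c4: "(\<lambda>x. x i) \<in> measurable (gaussian d \<mu>) borel"
    using i by (simp cong: measurable_cong_sets add: sets_gaussian)
  have c34: "(\<lambda>x. x j i) \<in> measurable ?G borel" using measurable_compose[OF c3 c4] .
  have c234: "(\<lambda>x. snd x j i) \<in> measurable (N k) borel" using measurable_compose[OF c2 c34] .
  have c: "(\<lambda>\<omega>. snd (\<omega> k) j i) \<in> borel_measurable Q" using measurable_compose[OF c1 c234] .
  have "distr Q borel (\<lambda>\<omega>. snd (\<omega> k) j i) = distr (distr Q (N k) (\<lambda>\<omega>. \<omega> k)) borel (\<lambda>x. snd x j i)"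
    using distr_distr[OF c234 c1] by (simp add: comp_def)
  also have "distr Q (N k) (\<lambda>\<omega>. \<omega> k) = N k" unfolding Q_def using k by (intro P.PiM_component) simp
  also have "distr (N k) borel (\<lambda>x. snd x j i) = distr (distr (N k) ?G snd) borel (\<lambda>x. x j i)"
    using distr_distr[OF c34 c2] by (simp add: comp_def)
  also have "distr (N k) ?G snd = ?G" by (rule distr_snd_user)
  also have "distr ?G borel (\<lambda>x. x j i) = distr (distr ?G (gaussian d \<mu>) (\<lambda>x. x j)) borel (\<lambda>x. x i)"
    using distr_distr[OF c4 c3] by (simp add: comp_def)
  also have "distr ?G (gaussian d \<mu>) (\<lambda>x. x j) = gaussian d \<mu>" using j by (intro PG.PiM_component) simp
  also have "distr (gaussian d \<mu>) borel (\<lambda>x. x i) = density lborel (\<lambda>x. ennreal (normal_density (\<mu> i) 1 x))"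
    by (rule distr_gaussian_component[OF i])
  finally have "distr Q borel (\<lambda>\<omega>. snd (\<omega> k) j i) = density lborel (\<lambda>x. ennreal (normal_density (\<mu> i) 1 x))" .
  moreover have "distr Q lborel (\<lambda>\<omega>. snd (\<omega> k) j i) = distr Q borel (\<lambda>\<omega>. snd (\<omega> k) j i)"
    by (intro distr_cong) auto
  ultimately show ?thesis using c by (simp add: distributed_def)
qed

context
  fixes l :: nat and v :: "nat \<Rightarrow> real" and Y :: "nat \<times> nat \<Rightarrow> (nat \<Rightarrow> real \<times> (nat \<Rightarrow> nat \<Rightarrow> real)) \<Rightarrow> real"
  assumes l: "l \<ge> 1" "l \<le> d" and v: "v 0 > 0"
  defines "Y \<equiv> \<lambda>p \<omega>. sgn1 (block_sum v d l (m (fst p)) (snd (\<omega> (fst p))) (snd p))"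
begin

text \<open>A flat index set for the sample coordinates that enter one bit. For different bits these
  sets are disjoint, which is the source of the independence of the bits.\<close>

definition block_index :: "nat \<Rightarrow> nat \<Rightarrow> (nat \<times> nat \<times> nat) set" where
  "block_index k g = {k} \<times> {..<m k} \<times> block d l g"

lemma block_sum_eq_sum_block_index:
  "block_sum v d l (m k) (snd (\<omega> k)) g = (\<Sum>q\<in>block_index k g. v (snd (snd q) div l) * snd (\<omega> (fst q)) (fst (snd q)) (snd (snd q)))"
  unfolding block_sum_def block_index_def
  by (simp add: sum.cartesian_product[symmetric] case_prod_unfold sum.cartesian_product')

lemma indep_vars_block_signs: "prob_space.indep_vars Q (\<lambda>_. borel) Y ({..<n} \<times> {..<l})"
proof -
  interpret Q: prob_space Q by (rule prob_space_users)
  let ?X = "\<lambda>q \<omega>. snd (\<omega> (fst q)) (fst (snd q)) (snd (snd q)) :: real"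
  let ?K = "\<lambda>p. block_index (fst p) (snd p)"
  have "Q.indep_vars (\<lambda>p. PiM (?K p) (\<lambda>_. borel)) (\<lambda>p \<omega>. restrict (\<lambda>q. ?X q \<omega>) (?K p)) ({..<n} \<times> {..<l})"
    by (rule Q.indep_vars_restrict[OF indep_vars_sample_coordinates])
      (auto simp: disjoint_family_on_def block_index_def block_def)
  then have "Q.indep_vars (\<lambda>_. borel) (\<lambda>p \<omega>. (\<lambda>f. sgn1 (\<Sum>q\<in>?K p. v (snd (snd q) div l) * f q))
     (restrict (\<lambda>q. ?X q \<omega>) (?K p))) ({..<n} \<times> {..<l})"
    by (rule Q.indep_vars_compose2) measurable
  moreover have "(\<lambda>\<omega>. (\<lambda>f. sgn1 (\<Sum>q\<in>?K p. v (snd (snd q) div l) * f q)) (restrict (\<lambda>q. ?X q \<omega>) (?K p))) = Y p" for p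
    unfolding Y_def block_sum_eq_sum_block_index by (intro ext) (simp cong: sum.cong)
  ultimately show ?thesis by (simp only:)
qed

text \<open>The projection is normal with mean \<open>m k * a\<close> and variance
  \<open>m k * b\<close>; only the ratio of mean to deviation matters for the sign, and it retains
  the factor \<open>sqrt (m k)\<close>.\<close>

lemma expectation_block_sign:
  assumes k: "k < n" and g: "g < l"
  shows "prob_space.expectation Q (Y (k, g)) = sign_bias (sqrt (real (m k)) *
    ((\<Sum>i\<in>block d l g. v (i div l) * \<mu> i) / sqrt (\<Sum>i\<in>block d l g. (v (i div l))\<^sup>2)))"
proof -
  interpret Q: prob_space Q by (rule prob_space_users)
  let ?X = "\<lambda>q \<omega>. snd (\<omega> (fst q)) (fst (snd q)) (snd (snd q)) :: real"
  let ?c = "\<lambda>q :: nat \<times> nat \<times> nat. v (snd (snd q) div l)"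
  define a where "a = (\<Sum>i\<in>block d l g. v (i div l) * \<mu> i)"
  define b where "b = (\<Sum>i\<in>block d l g. (v (i div l))\<^sup>2)"
  \<comment> \<open>Coordinate g has position 0 in its block, so the positive entry
    \<open>v 0\<close> makes the variance positive.\<close>
  have gb: "g \<in> block d l g" "g div l = 0" using g l by (auto simp: block_def)
  have b0: "b > 0" unfolding b_def using gb v by (intro sum_pos2[of _ g]) auto
  have m0: "real (m k) > 0" using m[OF k] by simp
  have fin: "finite (block_index k g)" by (simp add: block_index_def)
  have sub: "block_index k g \<subseteq> Sigma {..<n} (\<lambda>k. {..<m k} \<times> {..<d})"
    using k by (auto simp: block_index_def block_def)
  have sum: "(\<Sum>q\<in>block_index k g. f (snd (snd q))) = real (m k) * (\<Sum>i\<in>block d l g. f i)" for f :: "nat \<Rightarrow> real"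
    unfolding block_index_def by (simp add: sum.cartesian_product[symmetric] case_prod_unfold sum.cartesian_product')
  have "distributed Q lborel (\<lambda>\<omega>. \<Sum>q\<in>block_index k g. ?c q * ?X q \<omega>)
    (normal_density (\<Sum>q\<in>block_index k g. ?c q * \<mu> (snd (snd q))) (sqrt (\<Sum>q\<in>block_index k g. (?c q)\<^sup>2)))"
  proof (rule Q.distributed_weighted_sum_normal[OF fin])
    show "Q.indep_vars (\<lambda>_. borel) ?X (block_index k g)"
      by (rule Q.indep_vars_subset[OF indep_vars_sample_coordinates sub])
    show "distributed Q lborel (?X q) (normal_density (\<mu> (snd (snd q))) 1)" if "q \<in> block_index k g" for q
      using that k by (intro distributed_sample_coordinate) (auto simp: block_index_def block_def)
    show "\<exists>q\<in>block_index k g. ?c q \<noteq> 0"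
      using gb v m[OF k] by (intro bexI[of _ "(k, 0, g)"]) (auto simp: block_index_def)
  qed
  then have "distributed Q lborel (\<lambda>\<omega>. block_sum v d l (m k) (snd (\<omega> k)) g)
    (normal_density (real (m k) * a) (sqrt (real (m k) * b)))"
    unfolding block_sum_eq_sum_block_index a_def b_def sum[of "\<lambda>i. v (i div l) * \<mu> i"] sum[of "\<lambda>i. (v (i div l))\<^sup>2"] .
  then have "Q.expectation (\<lambda>\<omega>. sgn1 (block_sum v d l (m k) (snd (\<omega> k)) g)) = sign_bias (real (m k) * a / sqrt (real (m k) * b))"
    using b0 m0 by (intro Q.expectation_sgn1_normal) auto
  also have "real (m k) * a / sqrt (real (m k) * b) = sqrt (real (m k)) * (a / sqrt b)"
    using m0 b0 real_sqrt_mult_self[of "real (m k)"] by (simp add: real_sqrt_mult field_simps)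
  finally show ?thesis by (simp add: Y_def a_def b_def)
qed

end

end

subsection \<open>The protocol\<close>

text \<open>Blocks are padded by zeros to the common length \<open>d div l + 1\<close>, since the
  position \<open>d div l\<close> exists only in the first \<open>d mod l\<close> of them.\<close>

lemma sum_block_reindex:
  assumes l: "l \<ge> 1" and g: "g < l"
  shows "(\<Sum>i\<in>block d l g. f (i div l) i) = (\<Sum>j<d div l + 1. if g + l * j < d then f j (g + l * j) else (0 :: real))"
proof -
  have "(\<Sum>j<d div l + 1. if g + l * j < d then f j (g + l * j) else 0)
      = (\<Sum>j\<in>{j. j < d div l + 1 \<and> g + l * j < d}. f j (g + l * j))"
    by (subst sum.inter_filter[symmetric]) auto
  also have "\<dots> = (\<Sum>i\<in>block d l g. f (i div l) i)"
  proof (rule sum.reindex_bij_witness[where i="\<lambda>i. i div l" and j="\<lambda>j. g + l * j"])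
    fix i assume "i \<in> block d l g"
    then have i: "i < d" "i mod l = g" by (auto simp: block_def)
    then show e: "g + l * (i div l) = i" by (metis add.commute mult_div_mod_eq)
    have "i div l \<le> d div l" using i by (intro div_le_mono) simp
    then show "i div l \<in> {j. j < d div l + 1 \<and> g + l * j < d}" using e i by simp
  qed (use l g in \<open>auto simp: block_def\<close>)
  finally show ?thesis by simp
qed

lemma sum_blocks:
  assumes "l \<ge> 1"
  shows "(\<Sum>g<l. \<Sum>i\<in>block d l g. f i) = (\<Sum>i<d. f i :: real)"
proof -
  have "(\<Sum>g<l. sum f {i \<in> {..<d}. i mod l = g}) = sum f {..<d}"
    using assms by (intro sum.group) auto
  then show ?thesis by (simp add: block_def)
qed

text \<open>Either one summand reaches the cap e by itself, or none is cut.\<close>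

lemma sum_min_ge:
  fixes x :: "'a \<Rightarrow> real"
  assumes "finite S" "\<And>i. i \<in> S \<Longrightarrow> x i \<ge> 0" "e \<ge> 0"
  shows "(\<Sum>i\<in>S. min (x i) e) \<ge> min (\<Sum>i\<in>S. x i) e"
proof (cases "\<exists>i\<in>S. x i \<ge> e")
  case True
  then obtain i where i: "i \<in> S" "x i \<ge> e" by auto
  then have "min (x i) e \<le> (\<Sum>i\<in>S. min (x i) e)" using assms by (intro member_le_sum) auto
  then show ?thesis using i by auto
next
  case False
  then have "(\<Sum>i\<in>S. min (x i) e) = (\<Sum>i\<in>S. x i)" by (intro sum.cong) auto
  then show ?thesis by simp
qed

lemma square_sum_minus_sum_squares:
  fixes p :: "nat \<Rightarrow> real"
  shows "(\<Sum>k<n. p k)\<^sup>2 - (\<Sum>k<n. (p k)\<^sup>2) = (\<Sum>k1<n. \<Sum>k2\<in>{..<n} - {k1}. p k1 * p k2)"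
proof -
  have "(\<Sum>k2\<in>{..<n} - {k1}. p k1 * p k2) = (\<Sum>k2<n. p k1 * p k2) - (p k1)\<^sup>2" if "k1 < n" for k1
    using that by (simp add: sum_diff1 power2_eq_square)
  then have "(\<Sum>k1<n. \<Sum>k2\<in>{..<n} - {k1}. p k1 * p k2) = (\<Sum>k1<n. (\<Sum>k2<n. p k1 * p k2) - (p k1)\<^sup>2)"
    by (intro sum.cong) auto
  then show ?thesis by (simp add: sum_subtractf power2_eq_square[of "sum p _"] sum_product)
qed

text \<open>Both biases carry the sign of \<theta>, so their product is nonnegative in either case.
  Below the cap e the arguments stay within 1, where the size of the bias is at least one third of
  that of its argument; two factors 1/3 make 1/9.\<close>

lemma sign_bias_mult_ge:
  assumes e: "0 \<le> e" and a: "0 \<le> a" "a * e \<le> 1" and b: "0 \<le> b" "b * e \<le> 1"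
  shows "sign_bias (a * \<theta>) * sign_bias (b * \<theta>) \<ge> a * b * (min \<bar>\<theta>\<bar> e)\<^sup>2 / 9"
proof -
  define \<tau> where "\<tau> = min \<bar>\<theta>\<bar> e"
  have \<tau>: "0 \<le> \<tau>" "\<tau> \<le> \<bar>\<theta>\<bar>" "\<tau> \<le> e" using e by (auto simp: \<tau>_def)
  have x: "c * \<tau> / 3 \<le> min (c * \<bar>\<theta>\<bar>) 1 / 3" if "0 \<le> c" "c * e \<le> 1" for c
    using mult_left_mono[OF \<tau>(2) that(1)] mult_left_mono[OF \<tau>(3) that(1)] that(2) by simp
  have mono: "(a * \<tau> / 3) * (b * \<tau> / 3) \<le> X * Y" if "a * \<tau> / 3 \<le> X" "b * \<tau> / 3 \<le> Y" for X Y
  proof -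
    have nn: "0 \<le> a * \<tau> / 3" "0 \<le> b * \<tau> / 3" using a b \<tau> by auto
    show ?thesis by (rule mult_mono[OF that order_trans[OF nn(1) that(1)] nn(2)])
  qed
  have "(a * \<tau> / 3) * (b * \<tau> / 3) \<le> sign_bias (a * \<theta>) * sign_bias (b * \<theta>)"
  proof (cases "\<theta> \<ge> 0")
    case True
    have "c * \<tau> / 3 \<le> sign_bias (c * \<theta>)" if "0 \<le> c" "c * e \<le> 1" for c
      by (rule order_trans[OF x[OF that]]) (use sign_bias_pos[of "c * \<theta>"] True that in simp)
    then show ?thesis using a b by (intro mono) auto
  next
    case False
    have "c * \<tau> / 3 \<le> - sign_bias (c * \<theta>)" if "0 \<le> c" "c * e \<le> 1" for c
      by (rule order_trans[OF x[OF that]]) (use sign_bias_neg[of "c * \<theta>"] False that in \<open>simp add: mult_nonneg_nonpos\<close>)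
    then have "(a * \<tau> / 3) * (b * \<tau> / 3) \<le> (- sign_bias (a * \<theta>)) * (- sign_bias (b * \<theta>))"
      using a b by (intro mono) auto
    then show ?thesis by simp
  qed
  then show ?thesis by (simp add: \<tau>_def power2_eq_square mult_ac)
qed

text \<open>A good block turns at least the fraction \<open>\<delta> / D\<close> of its capped
  energy into the capped square of its normalized mean, and the good blocks carry half of the total.
  With \<open>D \<le> 2 * d / l\<close>, the two factors of 2 make the 4.\<close>

lemma block_signal_ge:
  fixes v \<mu> :: "nat \<Rightarrow> real" and \<delta> \<epsilon> :: real
  assumes l: "1 \<le> l" "l \<le> d" and \<epsilon>: "0 < \<epsilon>" and \<delta>: "0 < \<delta>" "\<delta> \<le> 1"
    and v0: "v 0 > 0" and v1: "(\<Sum>j<d div l + 1. (v j)\<^sup>2) \<le> 1"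
  defines "a \<equiv> \<lambda>g j. if g + l * j < d then \<mu> (g + l * j) else 0"
    and "D \<equiv> d div l + 1"
  defines "w \<equiv> \<lambda>g. min (\<Sum>j<D. (a g j)\<^sup>2) (\<epsilon>\<^sup>2)"
    and "\<theta> \<equiv> \<lambda>g. (\<Sum>i\<in>block d l g. v (i div l) * \<mu> i) / sqrt (\<Sum>i\<in>block d l g. (v (i div l))\<^sup>2)"
  assumes good: "(\<Sum>g | g < l \<and> (\<Sum>j<D. v j * a g j)\<^sup>2 \<ge> \<delta> * (\<Sum>j<D. (a g j)\<^sup>2) / real D. w g) \<ge> (\<Sum>g<l. w g) / 2"
    and W: "(\<Sum>g<l. w g) \<ge> \<epsilon>\<^sup>2"
  shows "(\<Sum>g<l. (min \<bar>\<theta> g\<bar> \<epsilon>)\<^sup>2) \<ge> \<delta> * \<epsilon>\<^sup>2 * real l / (4 * real d)"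
proof -
  have D0: "real D \<ge> 1" by (simp add: D_def)
  have dl: "real D \<le> 2 * real d / real l"
  proof -
    have "real (d div l) \<le> real d / real l" by (rule of_nat_div_le_of_nat)
    moreover have "1 \<le> real d / real l" using l by simp
    ultimately show ?thesis by (simp add: D_def)
  qed
  have \<delta>D: "0 < \<delta> / real D" "\<delta> / real D \<le> 1" using \<delta> D0 by (auto simp: divide_le_eq)
  have key: "\<delta> / real D * w g \<le> (min \<bar>\<theta> g\<bar> \<epsilon>)\<^sup>2"
    if g: "g < l" and gg: "(\<Sum>j<D. v j * a g j)\<^sup>2 \<ge> \<delta> * (\<Sum>j<D. (a g j)\<^sup>2) / real D" for g
  proof -
    define b where "b = (\<Sum>i\<in>block d l g. (v (i div l))\<^sup>2)"
    have gb: "g \<in> block d l g" "g div l = 0" using g l by (auto simp: block_def)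
    have b0: "b > 0" unfolding b_def using gb v0 by (intro sum_pos2[of _ g]) auto
    have "b = (\<Sum>j<D. if g + l * j < d then (v j)\<^sup>2 else 0)"
      unfolding b_def D_def using sum_block_reindex[OF l(1) g, where f="\<lambda>j i. (v j)\<^sup>2"] .
    also have "\<dots> \<le> (\<Sum>j<D. (v j)\<^sup>2)" by (intro sum_mono) auto
    finally have b1: "b \<le> 1" using v1 by (simp add: D_def)
    have num: "(\<Sum>i\<in>block d l g. v (i div l) * \<mu> i) = (\<Sum>j<D. v j * a g j)"
      unfolding D_def sum_block_reindex[OF l(1) g, where f="\<lambda>j i. v j * \<mu> i"]
      by (intro sum.cong) (auto simp: a_def)
    have "(\<theta> g)\<^sup>2 = (\<Sum>j<D. v j * a g j)\<^sup>2 / b"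
      using b0 by (simp add: \<theta>_def num power_divide b_def[symmetric])
    \<comment> \<open>Here b is the squared norm of the direction on the positions present in the
      block; it is at most 1, so dividing by it only helps.\<close>
    also have "\<dots> \<ge> (\<Sum>j<D. v j * a g j)\<^sup>2 / 1" using b0 b1 by (intro divide_left_mono) auto
    finally have t: "(\<theta> g)\<^sup>2 \<ge> \<delta> / real D * (\<Sum>j<D. (a g j)\<^sup>2)" using gg by simp
    have m2: "(min \<bar>\<theta> g\<bar> \<epsilon>)\<^sup>2 = min ((\<theta> g)\<^sup>2) (\<epsilon>\<^sup>2)"
      using \<epsilon> abs_le_square_iff[of "\<theta> g" \<epsilon>] by (auto simp: min_def)
    have "\<delta> / real D * w g \<le> \<delta> / real D * (\<Sum>j<D. (a g j)\<^sup>2)"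
      using \<delta>D by (intro mult_left_mono) (auto simp: w_def)
    moreover have "\<delta> / real D * w g \<le> 1 * \<epsilon>\<^sup>2"
      using \<delta>D by (intro mult_mono) (auto simp: w_def sum_nonneg)
    ultimately show ?thesis unfolding m2 using t by simp
  qed
  let ?G = "{g. g < l \<and> (\<Sum>j<D. v j * a g j)\<^sup>2 \<ge> \<delta> * (\<Sum>j<D. (a g j)\<^sup>2) / real D}"
  have "\<delta> * \<epsilon>\<^sup>2 * real l / (4 * real d) = \<delta> / (2 * real d / real l) * (\<epsilon>\<^sup>2 / 2)"
    using l by (simp add: field_simps)
  also have "\<dots> \<le> \<delta> / real D * (\<epsilon>\<^sup>2 / 2)"
    using dl D0 \<delta> l by (intro mult_right_mono divide_left_mono) auto
  also have "\<dots> \<le> \<delta> / real D * sum w ?G" using good W \<delta>D by (intro mult_left_mono) auto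
  also have "\<dots> = (\<Sum>g\<in>?G. \<delta> / real D * w g)" by (rule sum_distrib_left)
  also have "\<dots> \<le> (\<Sum>g\<in>?G. (min \<bar>\<theta> g\<bar> \<epsilon>)\<^sup>2)" by (intro sum_mono key) auto
  also have "\<dots> \<le> (\<Sum>g<l. (min \<bar>\<theta> g\<bar> \<epsilon>)\<^sup>2)" by (intro sum_mono2) auto
  finally show ?thesis .
qed

lemma block_energy_ge:
  fixes \<mu> :: "nat \<Rightarrow> real"
  assumes l: "1 \<le> l" and \<epsilon>: "0 < \<epsilon>" and \<mu>: "L2_set \<mu> {..<d} \<ge> \<epsilon>"
  shows "(\<Sum>g<l. min (\<Sum>j<d div l + 1. (if g + l * j < d then \<mu> (g + l * j) else 0)\<^sup>2) (\<epsilon>\<^sup>2)) \<ge> \<epsilon>\<^sup>2"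
proof -
  let ?e = "\<lambda>g. \<Sum>j<d div l + 1. (if g + l * j < d then \<mu> (g + l * j) else 0)\<^sup>2"
  have eg: "?e g = (\<Sum>i\<in>block d l g. (\<mu> i)\<^sup>2)" if "g < l" for g
    unfolding sum_block_reindex[OF l that, where f="\<lambda>j i. (\<mu> i)\<^sup>2"] by (intro sum.cong) auto
  have "(\<Sum>g<l. ?e g) = (\<Sum>g<l. \<Sum>i\<in>block d l g. (\<mu> i)\<^sup>2)" by (rule sum.cong[OF refl], rule eg, simp)
  also have "\<dots> = (\<Sum>i<d. (\<mu> i)\<^sup>2)" by (rule sum_blocks[OF l])
  also have "\<dots> \<ge> \<epsilon>\<^sup>2"
  proof -
    have "\<epsilon>\<^sup>2 \<le> (L2_set \<mu> {..<d})\<^sup>2" using \<mu> \<epsilon> by (intro power_mono) auto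
    then show ?thesis by (simp add: L2_set_def sum_nonneg)
  qed
  finally have "min (\<Sum>g<l. ?e g) (\<epsilon>\<^sup>2) = \<epsilon>\<^sup>2" by simp
  then show ?thesis using sum_min_ge[of "{..<l}" ?e "\<epsilon>\<^sup>2"] by (simp add: sum_nonneg)
qed

section \<open>The protocol and its two errors\<close>

definition sign_protocol :: "nat \<Rightarrow> nat \<Rightarrow> nat \<Rightarrow> (nat \<Rightarrow> nat) \<Rightarrow> (bool list \<Rightarrow> nat \<Rightarrow> real) \<Rightarrow> real protocol" where
  "sign_protocol d n l m v =
    \<lparr>priv = \<lambda>_. return borel 0,
     enc = \<lambda>k u z x. map (\<lambda>g. block_sum (v u) d l (m k) x g \<ge> 0) [0..<l],
     test = \<lambda>y. 20 * real n * sqrt (real l) \<le> (\<Sum>g<l. (\<Sum>k<n. if y k ! g then 1 else - 1)\<^sup>2 - real n)\<rparr>"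

lemma is_protocol_sign_protocol: "is_protocol d n s m (\<lambda>_. l) (sign_protocol d n l m v)"
proof -
  have "(\<lambda>(u, z, x). map (\<lambda>g. block_sum (v u) d l (m k) x g \<ge> 0) [0..<l])
    \<in> uniform_count_measure (bits s) \<Otimes>\<^sub>M (return borel (0::real) \<Otimes>\<^sub>M PiM {..<m k} (\<lambda>_. PiM {..<d} (\<lambda>_. borel)))
         \<rightarrow>\<^sub>M count_space (bits l)" (is "?f \<in> ?U \<Otimes>\<^sub>M ?N \<rightarrow>\<^sub>M _") for k
  proof -
    have "(\<lambda>q. ?f (u, q)) \<in> ?N \<rightarrow>\<^sub>M count_space (bits l)" for u
    proof (subst measurable_count_space_eq2[OF finite_bits], intro conjI ballI)
      show "(\<lambda>q. ?f (u, q)) \<in> space ?N \<rightarrow> bits l" by (auto simp: bits_def)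
      fix b :: "bool list" assume b: "b \<in> bits l"
      have c: "(\<lambda>q. snd q j i) \<in> borel_measurable ?N" if "j < m k" "i < d" for j i
      proof -
        have "(\<lambda>x. x j) \<in> PiM {..<m k} (\<lambda>_. PiM {..<d} (\<lambda>_. borel :: real measure)) \<rightarrow>\<^sub>M PiM {..<d} (\<lambda>_. borel)"
          and "(\<lambda>x. x i) \<in> PiM {..<d} (\<lambda>_. borel :: real measure) \<rightarrow>\<^sub>M borel"
          using that by auto
        then have "(\<lambda>x. x j i) \<in> borel_measurable (PiM {..<m k} (\<lambda>_. PiM {..<d} (\<lambda>_. borel :: real measure)))"
          by (rule measurable_compose[where f="\<lambda>x. x j" and g="\<lambda>x. x i"])
        then show ?thesis by (rule measurable_compose[OF measurable_snd, where g="\<lambda>x. x j i"])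
      qed
      have [measurable]: "(\<lambda>q. block_sum (v u) d l (m k) (snd q) g) \<in> borel_measurable ?N" for g
        unfolding block_sum_def using c by (intro borel_measurable_sum borel_measurable_times) (auto simp: block_def)
      have nth: "map f [0..<l] = b \<longleftrightarrow> (\<forall>g\<in>{..<l}. f g = b ! g)" for f
        using b by (simp add: bits_def list_eq_iff_nth_eq Ball_def)
      have "(\<lambda>q. ?f (u, q)) -` {b} \<inter> space ?N = {q \<in> space ?N. \<forall>g\<in>{..<l}. (block_sum (v u) d l (m k) (snd q) g \<ge> 0) = b ! g}"
        unfolding vimage_def Int_def by (simp add: case_prod_unfold nth conj_commute)
      also have "\<dots> \<in> sets ?N" by measurable
      finally show "(\<lambda>q. ?f (u, q)) -` {b} \<inter> space ?N \<in> sets ?N" .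
    qed
    then have "?f \<in> count_space (bits s) \<Otimes>\<^sub>M ?N \<rightarrow>\<^sub>M count_space (bits l)"
      by (intro measurable_pair_measure_countable1 countable_finite finite_bits)
    moreover have "sets (count_space (bits s) \<Otimes>\<^sub>M ?N) = sets (?U \<Otimes>\<^sub>M ?N)"
      by (intro sets_pair_measure_cong) (auto simp: sets_uniform_count_measure)
    ultimately show ?thesis by (simp cong: measurable_cong_sets)
  qed
  then show ?thesis by (simp add: is_protocol_def sign_protocol_def prob_space_real_return)
qed

lemma measure_uniform_pair:
  assumes A: "finite A" "A \<noteq> {}" and Q: "prob_space Q" and S: "S \<in> sets (uniform_count_measure A \<Otimes>\<^sub>M Q)"
  shows "measure (uniform_count_measure A \<Otimes>\<^sub>M Q) S = (\<Sum>u\<in>A. measure Q (Pair u -` S)) / real (card A)"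
proof -
  interpret Q: prob_space Q by fact
  have c: "real (card A) > 0" using A by (simp add: card_gt_0_iff)
  have "emeasure (uniform_count_measure A \<Otimes>\<^sub>M Q) S = (\<integral>\<^sup>+u. emeasure Q (Pair u -` S) \<partial>uniform_count_measure A)"
    by (rule Q.emeasure_pair_measure_alt[OF S])
  also have "\<dots> = (\<Sum>u\<in>A. ennreal (measure Q (Pair u -` S) / real (card A)))"
    unfolding uniform_count_measure_def using A(1)
    by (subst nn_integral_point_measure_finite)
      (auto simp: Q.emeasure_eq_measure ennreal_mult'[symmetric] mult.commute intro!: sum.cong)
  also have "\<dots> = ennreal ((\<Sum>u\<in>A. measure Q (Pair u -` S)) / real (card A))"
    using c by (subst sum_ennreal) (auto simp: sum_divide_distrib)
  finally show ?thesis
    unfolding measure_def by (simp add: enn2real_ennreal sum_nonneg divide_nonneg_nonneg)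
qed

text \<open>Law of total probability over the seed: a bad seed costs at most 1, any other at most
  \<alpha>.\<close>

lemma output_prob_le:
  assumes P: "is_protocol d n s m (\<lambda>_. l) P" 
    and bad: "B \<subseteq> bits s" "real (card B) \<le> \<beta> * real (card (bits s))"
    and Q: "Q = PiM {..<n} (\<lambda>k. priv P k \<Otimes>\<^sub>M PiM {..<m k} (\<lambda>_. gaussian d \<mu>))" "prob_space Q"
    and good: "\<And>u. u \<in> bits s - B \<Longrightarrow> measure Q {\<omega> \<in> space Q. test P (messages n P (u, \<omega>)) = b} \<le> \<alpha>"
    and \<alpha>: "0 \<le> \<alpha>"
  shows "output_prob n s m P (gaussian d \<mu>) b \<le> \<alpha> + \<beta>"
proof -
  interpret Q: prob_space Q by (rule Q(2))
  let ?R = "run_space n s m P (gaussian d \<mu>)"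
  let ?S = "{\<omega> \<in> space ?R. test P (messages n P \<omega>) = b}"
  have R: "?R = uniform_count_measure (bits s) \<Otimes>\<^sub>M Q" by (simp add: run_space_def Q(1))
  have S: "?S \<in> sets ?R"
  proof -
    have "messages n P -` {y \<in> space (count_space (PiE {..<n} (\<lambda>k. bits l))). test P y = b} \<inter> space ?R \<in> sets ?R"
      by (rule measurable_sets[OF measurable_messages[OF P sets_gaussian]]) auto
    also have "messages n P -` {y \<in> space (count_space (PiE {..<n} (\<lambda>k. bits l))). test P y = b} \<inter> space ?R = ?S"
      using measurable_space[OF measurable_messages[OF P sets_gaussian]] by auto
    finally show ?thesis .
  qed
  have N: "real (card (bits s)) > 0" using finite_bits bits_nonempty by (simp add: card_gt_0_iff)
  have fB: "finite B" using bad(1) finite_bits finite_subset by blast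
  have slice: "Pair u -` ?S = {\<omega> \<in> space Q. test P (messages n P (u, \<omega>)) = b}" if "u \<in> bits s" for u
    using that by (auto simp: R space_pair_measure space_uniform_count_measure)
  have "output_prob n s m P (gaussian d \<mu>) b = (\<Sum>u\<in>bits s. measure Q (Pair u -` ?S)) / real (card (bits s))"
    using S unfolding output_prob_def R by (intro measure_uniform_pair finite_bits bits_nonempty Q(2)) 
  also have "(\<Sum>u\<in>bits s. measure Q (Pair u -` ?S)) \<le> (\<Sum>u\<in>bits s. \<alpha> + (if u \<in> B then 1 else 0))"
  proof (rule sum_mono)
    fix u assume u: "u \<in> bits s"
    show "measure Q (Pair u -` ?S) \<le> \<alpha> + (if u \<in> B then 1 else 0)"
    proof (cases "u \<in> B")
      case True
      have "measure Q (Pair u -` ?S) \<le> 1" by (rule Q.prob_le_1)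
      with \<alpha> show ?thesis by (simp only: True if_True)
    next
      case False
      then show ?thesis using good[of u] u by (simp only: slice[OF u]) simp
    qed
  qed
  also have "\<dots> = \<alpha> * real (card (bits s)) + real (card B)"
    using bad(1) by (simp add: sum.distrib sum.If_cases finite_bits Int_absorb1)
  also have "\<dots> \<le> (\<alpha> + \<beta>) * real (card (bits s))" using bad(2) by (simp add: algebra_simps)
  finally show ?thesis using N by (simp add: divide_right_mono pos_divide_le_eq)
qed

text \<open>With bits read as signs, whose squares are 1, the square minus n counts the agreeing
  minus the disagreeing ordered pairs of distinct users at position g.\<close>

lemma sign_protocol_test_eq:
  "test (sign_protocol d n l m v) (messages n (sign_protocol d n l m v) (u, \<omega>)) \<longleftrightarrow>
    20 * real n * sqrt (real l) \<le> (\<Sum>g<l. (\<Sum>k<n. sgn1 (block_sum (v u) d l (m k) (snd (\<omega> k)) g))\<^sup>2 - real n)"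
proof -
  let ?P = "sign_protocol d n l m v"
  have test: "test ?P y \<longleftrightarrow> 20 * real n * sqrt (real l) \<le> (\<Sum>g<l. (\<Sum>k<n. if y k ! g then 1 else - 1)\<^sup>2 - real n)" for y
    by (simp add: sign_protocol_def)
  have "(\<Sum>k<n. if messages n ?P (u, \<omega>) k ! g then 1 else - 1)
    = (\<Sum>k<n. sgn1 (block_sum (v u) d l (m k) (snd (\<omega> k)) g))" if "g < l" for g
    using that by (intro sum.cong) (auto simp: messages_def sign_protocol_def sgn1_def)
  then have "(\<Sum>g<l. (\<Sum>k<n. if messages n ?P (u, \<omega>) k ! g then 1 else - 1)\<^sup>2 - real n)
    = (\<Sum>g<l. (\<Sum>k<n. sgn1 (block_sum (v u) d l (m k) (snd (\<omega> k)) g))\<^sup>2 - real n)"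
    by (intro sum.cong[OF refl]) simp
  then show ?thesis unfolding test by (simp only:)
qed

text \<open>The bits are exactly fair for every seed, so the set of bad seeds is empty and only the
  error of Chebyshev's inequality remains.\<close>

lemma sign_protocol_null_error:
  assumes d: "d \<ge> 1" and n: "n \<ge> 1" and m: "\<And>k. k < n \<Longrightarrow> m k \<ge> 1" and l: "1 \<le> l" "l \<le> d"
    and v: "\<And>u. u \<in> bits s \<Longrightarrow> v u 0 > 0"
  shows "output_prob n s m (sign_protocol d n l m v) (gaussian d (\<lambda>_. 0)) True \<le> 1 / 20"
proof -
  let ?P = "sign_protocol d n l m v"
  define Q where "Q = PiM {..<n} (\<lambda>k. return borel (0 :: real) \<Otimes>\<^sub>M PiM {..<m k} (\<lambda>_. gaussian d (\<lambda>_. 0)))"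
  have Q: "prob_space Q" unfolding Q_def by (rule prob_space_users[OF d n m])
  interpret Q: prob_space Q by (rule Q)
  have "output_prob n s m ?P (gaussian d (\<lambda>_. 0)) True \<le> 1 / 20 + 0"
  proof (rule output_prob_le[OF is_protocol_sign_protocol, where B="{}" and Q=Q])
    show "Q = PiM {..<n} (\<lambda>k. priv ?P k \<Otimes>\<^sub>M PiM {..<m k} (\<lambda>_. gaussian d (\<lambda>_. 0)))"
      by (simp add: Q_def sign_protocol_def)
    fix u assume "u \<in> bits s - {}"
    then have v0: "v u 0 > 0" by (simp add: v)
    define Y where "Y p \<omega> = sgn1 (block_sum (v u) d l (m (fst p)) (snd (\<omega> (fst p))) (snd p))"
      for p :: "nat \<times> nat" and \<omega> :: "nat \<Rightarrow> real \<times> (nat \<Rightarrow> nat \<Rightarrow> real)"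
    have ind: "Q.indep_vars (\<lambda>_. borel) Y ({..<n} \<times> {..<l})"
      unfolding Y_def[abs_def] Q_def by (rule indep_vars_block_signs[where v="v u", OF d n m l v0])
    have mean: "Q.expectation (Y (k, g)) = 0" if "k < n" "g < l" for k g
      using expectation_block_sign[where v="v u" and m=m and \<mu>="\<lambda>_. 0", OF d n m l v0 that] by (simp add: Y_def[abs_def] Q_def sign_bias_0)
    have pm: "(Y p \<omega>)\<^sup>2 = 1" for p \<omega> by (simp add: Y_def sgn1_def)
    have "Q.prob {\<omega> \<in> space Q. (\<Sum>g<l. (\<Sum>k<n. Y (k, g) \<omega>)\<^sup>2 - real n) \<ge> 20 * real n * sqrt (real l)} \<le> 1 / 20"
      by (rule Q.total_collision_statistic_tests(1)[OF n l(1) ind pm mean]) simp_all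
    then show "Q.prob {\<omega> \<in> space Q. test ?P (messages n ?P (u, \<omega>)) = True} \<le> 1 / 20"
      by (simp add: sign_protocol_test_eq Y_def)
  qed (simp_all add: Q)
  then show ?thesis by simp
qed

text \<open>The constant 36000 is the product of 1000, the signal required by the test, of 9, from
  the two factors 1/3 of the sign bias, and of 4, the loss in \<open>block_signal_ge\<close>. The
  error is 1/20 from the test plus 2/40 from the bad seeds.\<close>

lemma sign_protocol_alt_error:
  assumes d: "d \<ge> 1" and n: "n \<ge> 1" and m: "\<And>k. k < n \<Longrightarrow> m k \<ge> 1" and l: "1 \<le> l" "l \<le> d"
    and v: "spread_family (1 / 40) \<delta> (d div l + 1) (bits s) v" and \<delta>: "0 < \<delta>" "\<delta> \<le> 1"
    and \<epsilon>: "0 < \<epsilon>" and m\<epsilon>: "\<And>k. k < n \<Longrightarrow> sqrt (real (m k)) * \<epsilon> \<le> 1"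
    and \<mu>: "L2_set \<mu> {..<d} \<ge> \<epsilon>"
    and A: "(\<Sum>k1<n. \<Sum>k2\<in>{..<n} - {k1}. sqrt (real (m k1) * real (m k2)))
      \<ge> 36000 / \<delta> * (real d / (sqrt (real l) * \<epsilon>\<^sup>2)) * real n"
  shows "output_prob n s m (sign_protocol d n l m v) (gaussian d \<mu>) False \<le> 1 / 10"
proof -
  let ?P = "sign_protocol d n l m v"
  define Q where "Q = PiM {..<n} (\<lambda>k. return borel (0 :: real) \<Otimes>\<^sub>M PiM {..<m k} (\<lambda>_. gaussian d \<mu>))"
  have Q: "prob_space Q" unfolding Q_def by (rule prob_space_users[OF d n m])
  interpret Q: prob_space Q by (rule Q)
  define D where "D = d div l + 1"
  define a where "a g j = (if g + l * j < d then \<mu> (g + l * j) else 0)" for g j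
  define w where "w g = min (\<Sum>j<D. (a g j)\<^sup>2) (\<epsilon>\<^sup>2)" for g
  have W: "(\<Sum>g<l. w g) \<ge> \<epsilon>\<^sup>2"
    using block_energy_ge[OF l(1) \<epsilon> \<mu>] by (simp add: w_def a_def D_def)
  \<comment> \<open>Bad seeds: the blocks well captured by the direction carry less than half of the
    capped energy. The set depends on the unknown mean, but it enters the analysis only and not the
    protocol.\<close>
  define B where "B = {u\<in>bits s. (\<Sum>g | g < l \<and> (\<Sum>j<D. v u j * a g j)\<^sup>2 \<ge> \<delta> * (\<Sum>j<D. (a g j)\<^sup>2) / real D. w g)
      < (\<Sum>g<l. w g) / 2}"
  have cB: "real (card B) \<le> 2 * (1 / 40) * real (card (bits s))"
    unfolding B_def
  proof (rule spread_family_blocks[OF v[folded D_def]])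
    show "0 < (\<Sum>g<l. w g)" using W zero_less_power[OF \<epsilon>, of 2] by linarith
  qed (simp add: w_def sum_nonneg)
  have "output_prob n s m ?P (gaussian d \<mu>) False \<le> 1 / 20 + 2 * (1 / 40)"
  proof (rule output_prob_le[OF is_protocol_sign_protocol _ cB, where Q=Q])
    show "B \<subseteq> bits s" by (auto simp: B_def)
    show "Q = PiM {..<n} (\<lambda>k. priv ?P k \<Otimes>\<^sub>M PiM {..<m k} (\<lambda>_. gaussian d \<mu>))"
      by (simp add: Q_def sign_protocol_def)
    fix u assume u: "u \<in> bits s - B"
    then have v0: "v u 0 > 0" and v1: "(\<Sum>j<d div l + 1. (v u j)\<^sup>2) \<le> 1"
      using v by (auto simp: spread_family_def)
    have good: "(\<Sum>g | g < l \<and> (\<Sum>j<D. v u j * a g j)\<^sup>2 \<ge> \<delta> * (\<Sum>j<D. (a g j)\<^sup>2) / real D. w g)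
      \<ge> (\<Sum>g<l. w g) / 2" using u by (auto simp: B_def)
    define \<theta> where "\<theta> g = (\<Sum>i\<in>block d l g. v u (i div l) * \<mu> i) / sqrt (\<Sum>i\<in>block d l g. (v u (i div l))\<^sup>2)" for g
    define p where "p k g = sign_bias (sqrt (real (m k)) * \<theta> g)" for k g
    define A' where "A' = (\<Sum>k1<n. \<Sum>k2\<in>{..<n} - {k1}. sqrt (real (m k1) * real (m k2)))"
    define Y where "Y q \<omega> = sgn1 (block_sum (v u) d l (m (fst q)) (snd (\<omega> (fst q))) (snd q))"
      for q :: "nat \<times> nat" and \<omega> :: "nat \<Rightarrow> real \<times> (nat \<Rightarrow> nat \<Rightarrow> real)"
    have ind: "Q.indep_vars (\<lambda>_. borel) Y ({..<n} \<times> {..<l})"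
      unfolding Y_def[abs_def] Q_def by (rule indep_vars_block_signs[where v="v u", OF d n m l v0])
    have mean: "Q.expectation (Y (k, g)) = p k g" if "k < n" "g < l" for k g
      using expectation_block_sign[where v="v u" and m=m and \<mu>=\<mu>, OF d n m l v0 that] by (simp add: Y_def[abs_def] Q_def p_def \<theta>_def)
    have pm: "(Y q \<omega>)\<^sup>2 = 1" for q \<omega> by (simp add: Y_def sgn1_def)
    have signal: "(\<Sum>g<l. (min \<bar>\<theta> g\<bar> \<epsilon>)\<^sup>2) \<ge> \<delta> * \<epsilon>\<^sup>2 * real l / (4 * real d)"
      unfolding \<theta>_def using good W unfolding w_def a_def D_def
      by (intro block_signal_ge[where \<delta>=\<delta> and v="v u"] l \<epsilon> \<delta> v0 v1) auto
    have A'0: "A' \<ge> 0" by (auto simp: A'_def intro!: sum_nonneg)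
    \<comment> \<open>Expanding over ordered pairs of distinct users produces the sum in the
      hypothesis on the sample sizes, with the signal of the block as a common factor.\<close>
    have Eg: "(\<Sum>k<n. p k g)\<^sup>2 - (\<Sum>k<n. (p k g)\<^sup>2) \<ge> A' / 9 * (min \<bar>\<theta> g\<bar> \<epsilon>)\<^sup>2" for g
    proof -
      have "A' / 9 * (min \<bar>\<theta> g\<bar> \<epsilon>)\<^sup>2 = (\<Sum>k1<n. \<Sum>k2\<in>{..<n} - {k1}. sqrt (real (m k1)) * sqrt (real (m k2)) * (min \<bar>\<theta> g\<bar> \<epsilon>)\<^sup>2 / 9)"
        by (simp add: A'_def sum_distrib_right sum_divide_distrib real_sqrt_mult)
      also have "\<dots> \<le> (\<Sum>k1<n. \<Sum>k2\<in>{..<n} - {k1}. p k1 g * p k2 g)"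
        unfolding p_def using \<epsilon> m\<epsilon> by (intro sum_mono sign_bias_mult_ge) auto
      finally show ?thesis by (simp add: square_sum_minus_sum_squares)
    qed
    have "1000 * real n * sqrt (real l)
      = (36000 / \<delta> * (real d / (sqrt (real l) * \<epsilon>\<^sup>2)) * real n) / 9 * (\<delta> * \<epsilon>\<^sup>2 * real l / (4 * real d))"
    proof -
      have "real l = sqrt (real l) * sqrt (real l)" by simp
      moreover have "sqrt (real l) > 0" "real d > 0" using l d by auto
      ultimately show ?thesis using \<delta> \<epsilon> by (simp add: field_simps power2_eq_square)
    qed
    also have "\<dots> \<le> A' / 9 * (\<Sum>g<l. (min \<bar>\<theta> g\<bar> \<epsilon>)\<^sup>2)"
      using A signal A'0 \<delta> \<epsilon> unfolding A'_def by (intro mult_mono divide_right_mono) auto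
    also have "\<dots> = (\<Sum>g<l. A' / 9 * (min \<bar>\<theta> g\<bar> \<epsilon>)\<^sup>2)" by (rule sum_distrib_left)
    also have "\<dots> \<le> (\<Sum>g<l. (\<Sum>k<n. p k g)\<^sup>2 - (\<Sum>k<n. (p k g)\<^sup>2))" by (intro sum_mono Eg)
    finally have E: "1000 * real n * sqrt (real l) \<le> (\<Sum>g<l. (\<Sum>k<n. p k g)\<^sup>2 - (\<Sum>k<n. (p k g)\<^sup>2))" .
    have "Q.prob {\<omega> \<in> space Q. (\<Sum>g<l. (\<Sum>k<n. Y (k, g) \<omega>)\<^sup>2 - real n) < 20 * real n * sqrt (real l)} \<le> 1 / 20"
      by (rule Q.total_collision_statistic_tests(2)[OF n l(1) ind pm mean E])
    then show "Q.prob {\<omega> \<in> space Q. test ?P (messages n ?P (u, \<omega>)) = False} \<le> 1 / 20"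
      by (simp add: sign_protocol_test_eq Y_def not_le)
  qed (simp_all add: Q)
  then show ?thesis by simp
qed

theorem theorem2:
  shows "\<exists>C c r :: real. C > 0 \<and> c > 0 \<and> r > 0 \<and>
    (\<forall>(d::nat) (\<epsilon>::real) (l::nat) (s::nat) (n::nat) (m::nat \<Rightarrow> nat).
      d \<ge> 1 \<longrightarrow> 0 < \<epsilon> \<longrightarrow> \<epsilon> \<le> 1 \<longrightarrow>
      r \<le> real l \<longrightarrow> real l \<le> r * real d \<longrightarrow>
      real s \<ge> c * ln (real d / real l) \<longrightarrow>
      n \<ge> 1 \<longrightarrow>
      (\<forall>k<n. m k \<ge> 1 \<and> r \<le> real (m k) \<and> real (m k) \<le> r / \<epsilon>\<^sup>2) \<longrightarrow>
      (\<Sum>k1<n. \<Sum>k2\<in>{..<n} - {k1}. sqrt (real (m k1) * real (m k2))) / real n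
        \<ge> C * (real d / (sqrt (real l) * \<epsilon>\<^sup>2)) \<longrightarrow>
      (\<exists>P :: real protocol.
        is_protocol d n s m (\<lambda>_. l) P \<and>
        protocol_error d \<epsilon> n s m P \<le> 1 / 10))"
proof -
  obtain \<delta> :: real where \<delta>: "0 < \<delta>" "\<delta> \<le> 1"
    and spread: "\<And>D s. D \<ge> 1 \<Longrightarrow> 200 * (1 + ln (real D)) \<le> real s \<Longrightarrow> \<exists>u. spread_family (1 / 40) \<delta> D (bits s) u"
    using spread_family_exists by blast
  have main: "\<exists>P :: real protocol. is_protocol d n s m (\<lambda>_. l) P \<and> protocol_error d \<epsilon> n s m P \<le> 1 / 10"
    if d: "d \<ge> 1" and \<epsilon>: "0 < \<epsilon>" and l4: "1 / 4 \<le> real l" and ld4: "real l \<le> 1 / 4 * real d"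
      and s: "real s \<ge> 600 * ln (real d / real l)" and n: "n \<ge> 1"
      and m: "\<forall>k<n. m k \<ge> 1 \<and> 1 / 4 \<le> real (m k) \<and> real (m k) \<le> 1 / 4 / \<epsilon>\<^sup>2"
      and A: "(\<Sum>k1<n. \<Sum>k2\<in>{..<n} - {k1}. sqrt (real (m k1) * real (m k2))) / real n
        \<ge> 36000 / \<delta> * (real d / (sqrt (real l) * \<epsilon>\<^sup>2))"
    for d l s n :: nat and \<epsilon> :: real and m :: "nat \<Rightarrow> nat"
  proof -
    \<comment> \<open>As l is an integer, \<open>1/4 \<le> l\<close> already means
      \<open>1 \<le> l\<close>.\<close>
    have l: "1 \<le> l" "l \<le> d" using l4 ld4 by linarith+
    have m1: "\<And>k. k < n \<Longrightarrow> m k \<ge> 1" using m by auto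
    \<comment> \<open>The bound \<open>l \<le> d / 4\<close> gives
      \<open>ln (d / l) \<ge> ln 4 \<ge> 1\<close>, which absorbs the additive constants:
      \<open>200 * (2 + ln (d / l)) \<le> 600 * ln (d / l)\<close>. This is the origin of
      600.\<close>
    have "200 * (1 + ln (real (d div l + 1))) \<le> real s"
    proof -
      have q4: "4 \<le> real d / real l" using l ld4 by (simp add: le_divide_eq)
      have "ln (4 :: real) = ln (2 ^ 2)" by simp
      also have "\<dots> = 2 * ln 2" by (subst ln_realpow) auto
      finally have "1 \<le> ln (4 :: real)" using ln2_ge_two_thirds by simp
      also have "\<dots> \<le> ln (real d / real l)" using q4 by (subst ln_le_cancel_iff) auto
      finally have L: "1 \<le> ln (real d / real l)" .
      have "real (d div l) \<le> real d / real l" by (rule of_nat_div_le_of_nat)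
      then have "ln (real (d div l + 1)) \<le> ln (2 * (real d / real l))" using q4 by (subst ln_le_cancel_iff) auto
      also have "\<dots> = ln 2 + ln (real d / real l)" using l d by (subst ln_mult) auto
      also have "\<dots> \<le> 1 + ln (real d / real l)" using ln_le_minus_one[of "2 :: real"] by simp
      finally have "ln (real (d div l + 1)) \<le> 1 + ln (real d / real l)" .
      moreover have "200 * (1 + x) \<le> y" if "x \<le> 1 + z" "600 * z \<le> y" "1 \<le> z" for x y z :: real
      proof -
        have "200 * (1 + x) \<le> 200 * (2 + z)" using that(1) by simp
        also have "\<dots> \<le> 600 * z" using that(3) by simp
        finally show ?thesis using that(2) by simp
      qed
      ultimately show ?thesis using s L by blast
    qed
    then obtain v where v: "spread_family (1 / 40) \<delta> (d div l + 1) (bits s) v" using spread by fastforce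
    let ?P = "sign_protocol d n l m v"
    \<comment> \<open>The upper bound on the sample sizes places the capped arguments of
      \<open>sign_bias\<close> in its linear range.\<close>
    have m\<epsilon>: "sqrt (real (m k)) * \<epsilon> \<le> 1" if "k < n" for k
    proof -
      have "real (m k) * \<epsilon>\<^sup>2 \<le> 1 / 4" using m that \<epsilon> by (simp add: field_simps)
      then have "(sqrt (real (m k)) * \<epsilon>)\<^sup>2 \<le> 1\<^sup>2" by (simp add: power_mult_distrib)
      then show ?thesis by (rule power2_le_imp_le) simp
    qed
    have A': "(\<Sum>k1<n. \<Sum>k2\<in>{..<n} - {k1}. sqrt (real (m k1) * real (m k2)))
        \<ge> 36000 / \<delta> * (real d / (sqrt (real l) * \<epsilon>\<^sup>2)) * real n"
      using A n by (simp add: le_divide_eq)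
    have "output_prob n s m ?P (gaussian d (\<lambda>_. 0)) True \<le> 1 / 20"
      by (rule sign_protocol_null_error[OF d n m1 l]) (use v in \<open>auto simp: spread_family_def\<close>)
    then have null: "(SUP G\<in>null_hyp d. output_prob n s m ?P G True) \<le> 1 / 10" by (simp add: null_hyp_def)
    have alt: "(SUP G\<in>alt_hyp d \<epsilon>. output_prob n s m ?P G False) \<le> 1 / 10"
    proof (rule cSUP_least)
      \<comment> \<open>The least-upper-bound argument for a real supremum needs a nonempty index
        set; the constant vector \<epsilon> is an alternative.\<close>
      have "L2_set (\<lambda>_. \<epsilon>) {..<d} \<ge> \<epsilon>" using member_le_L2_set[of "{..<d}" 0 "\<lambda>_. \<epsilon>"] d by simp
      then show "alt_hyp d \<epsilon> \<noteq> {}" unfolding alt_hyp_def by blast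
      fix G assume "G \<in> alt_hyp d \<epsilon>"
      then obtain \<mu> where "G = gaussian d \<mu>" "L2_set \<mu> {..<d} \<ge> \<epsilon>" by (auto simp: alt_hyp_def)
      then show "output_prob n s m ?P G False \<le> 1 / 10"
        using sign_protocol_alt_error[OF d n m1 l v \<delta> \<epsilon> m\<epsilon> _ A'] by simp
    qed
    show ?thesis
      using is_protocol_sign_protocol null alt by (intro exI[of _ ?P]) (auto simp: protocol_error_def)
  qed
  have "36000 / \<delta> > 0" "(600 :: real) > 0" "(1 / 4 :: real) > 0" using \<delta> by auto
  with main show ?thesis by (intro exI[of _ "36000 / \<delta>"] exI[of _ 600] exI[of _ "1 / 4"] conjI allI impI)
qed

end
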